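(* Every finite, atomistic, join-semidistributive (respectively, finite, atomistic, lower bounded) lattice $L$ admits a $\langle\vee,\wedge,0,1,\mathsf{at}\rangle$-embedding with the congruence extension property into some finite, atomistic, join-semidistributive (respectively, finite, atomistic, lower bounded) lattice $L'$ such that all biatomicity problems in $L$ can be solved in $L'$. Here the last condition means, identifying $L$ with its image in $L'$: for every atom $p$ of $L$ and all $a,b\in L\setminus\{0\}$ such that $p\le a\vee b$, $p\nleq a$, and $p\nleq b$, there are atoms $x\le a$ and $y\le b$ of $L'$ such that $p\le x\vee y$ in $L'$.
   Context: A lattice with least element $0$ is atomistic if every element is a join of atoms ($0$ being the empty join). A lattice $L$ is join-semidistributive if $x\vee y=x\vee z$ implies $x\vee y=x\vee(y\wedge z)$, for all $x,y,z\in L$. A lattice homomorphism $f\colon K\to L$ is lower bounded if the preimage under $f$ of any principal dual ideal (principal filter) of $L$ is either empty or has a least element; a lattice $L$ is lower bounded if every homomorphism from a finitely generated lattice to $L$ is lower bounded. A $\langle\vee,\wedge,0,1,\mathsf{at}\rangle$-embedding is an injective lattice homomorphism that preserves the least element and the greatest element and sends atoms to atoms. A lattice embedding $f\colon K\hookrightarrow L$ has the congruence extension property if every congruence of $K$ is the inverse image under $f$ of some congruence of $L$. *)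

theory Defs
  imports "HOL-Algebra.Lattice" "HOL-Library.Countable_Set"
begin

section \<open>Atomistic and join-semidistributive lattices\<close>

definition atom :: "('a, 'm) gorder_scheme \<Rightarrow> 'a \<Rightarrow> bool" where
  "atom L p \<longleftrightarrow> p \<in> carrier L \<and> p \<noteq> \<bottom>\<^bsub>L\<^esub> \<and>
     (\<forall>x\<in>carrier L. x \<sqsubseteq>\<^bsub>L\<^esub> p \<longrightarrow> x = \<bottom>\<^bsub>L\<^esub> \<or> x = p)"

text \<open>The set \<open>A\<close> below may be empty, in which case its least upper bound is the least element.\<close>

locale atomistic_lattice = lattice L + weak_partial_order_bottom L for L (structure) +
  assumes join_of_atoms: "x \<in> carrier L \<Longrightarrow> \<exists>A. (\<forall>p\<in>A. atom L p) \<and> is_lub L x A"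

definition join_semidistributive :: "('a, 'm) gorder_scheme \<Rightarrow> bool" where
  "join_semidistributive L \<longleftrightarrow> lattice L \<and>
     (\<forall>x\<in>carrier L. \<forall>y\<in>carrier L. \<forall>z\<in>carrier L.
        x \<squnion>\<^bsub>L\<^esub> y = x \<squnion>\<^bsub>L\<^esub> z \<longrightarrow> x \<squnion>\<^bsub>L\<^esub> y = x \<squnion>\<^bsub>L\<^esub> (y \<sqinter>\<^bsub>L\<^esub> z))"


section \<open>Lower bounded lattices\<close>

definition lattice_hom :: "('a, 'm) gorder_scheme \<Rightarrow> ('b, 'n) gorder_scheme \<Rightarrow> ('a \<Rightarrow> 'b) \<Rightarrow> bool" where
  "lattice_hom K L f \<longleftrightarrow> f \<in> carrier K \<rightarrow> carrier L \<and> join_pres K L f \<and> meet_pres K L f"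

definition sublattice :: "('a, 'm) gorder_scheme \<Rightarrow> 'a set \<Rightarrow> bool" where
  "sublattice L S \<longleftrightarrow> S \<subseteq> carrier L \<and>
     (\<forall>x\<in>S. \<forall>y\<in>S. x \<squnion>\<^bsub>L\<^esub> y \<in> S \<and> x \<sqinter>\<^bsub>L\<^esub> y \<in> S)"

definition finitely_generated_lattice :: "('a, 'm) gorder_scheme \<Rightarrow> bool" where
  "finitely_generated_lattice K \<longleftrightarrow> lattice K \<and>
     (\<exists>X. finite X \<and> X \<subseteq> carrier K \<and> (\<forall>S. sublattice K S \<and> X \<subseteq> S \<longrightarrow> S = carrier K))"

definition lower_bounded_hom :: "('a, 'm) gorder_scheme \<Rightarrow> ('b, 'n) gorder_scheme \<Rightarrow> ('a \<Rightarrow> 'b) \<Rightarrow> bool" where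
  "lower_bounded_hom K L f \<longleftrightarrow> lattice_hom K L f \<and>
     (\<forall>a\<in>carrier L. let P = {x \<in> carrier K. a \<sqsubseteq>\<^bsub>L\<^esub> f x} in P = {} \<or> (\<exists>m. least K m P))"

text \<open>
  A definition cannot quantify over all types, so the domain \<open>K\<close> ranges over lattices carried by
  sets of natural numbers. Finitely generated lattices are countable, so nothing is lost:
  lemma \<open>lower_bounded_latticeD\<close> recovers the property for finitely generated lattices \<open>K\<close>
  over an arbitrary type.
\<close>

definition lower_bounded_lattice :: "('a, 'm) gorder_scheme \<Rightarrow> bool" where
  "lower_bounded_lattice L \<longleftrightarrow> lattice L \<and>
     (\<forall>(K :: nat gorder) f. finitely_generated_lattice K \<and> lattice_hom K L f
        \<longrightarrow> lower_bounded_hom K L f)"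

lemma finitely_generated_lattice_countable:
  assumes "finitely_generated_lattice K"
  shows "countable (carrier K)"
proof -
  from assms obtain X where X: "lattice K" "finite X" "X \<subseteq> carrier K"
    and gen: "\<And>S. sublattice K S \<Longrightarrow> X \<subseteq> S \<Longrightarrow> S = carrier K"
    unfolding finitely_generated_lattice_def by (elim conjE exE) simp
  interpret lattice K by (rule X)
  define F where "F A = A \<union> (\<Union>x\<in>A. \<Union>y\<in>A. {x \<squnion>\<^bsub>K\<^esub> y, x \<sqinter>\<^bsub>K\<^esub> y})" for A
  define G where "G n = (F ^^ n) X" for n
  define S where "S = (\<Union>n. G n)"
  have G0: "G 0 = X" and GSuc: "\<And>n. G (Suc n) = F (G n)" by (simp_all add: G_def)
  have sub: "G n \<subseteq> carrier K" for n
  proof (induction n)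
    case (Suc n)
    then show ?case unfolding GSuc F_def
      by (intro Un_least UN_least) (auto intro!: join_closed meet_closed)
  qed (simp add: X G0)
  have count: "countable (G n)" for n
  proof (induction n)
    case (Suc n)
    then show ?case unfolding GSuc F_def by (intro countable_Un countable_UN) simp_all
  qed (simp add: X G0 countable_finite)
  have mono: "G m \<subseteq> G n" if "m \<le> n" for m n
  proof (rule lift_Suc_mono_le[OF _ that])
    show "G n \<subseteq> G (Suc n)" for n
      unfolding GSuc F_def by (rule Un_upper1)
  qed
  have "sublattice K S"
    unfolding sublattice_def
  proof (intro conjI ballI)
    show "S \<subseteq> carrier K" using sub by (auto simp: S_def)
  next
    fix x y assume "x \<in> S" "y \<in> S"
    then obtain m n where "x \<in> G m" "y \<in> G n" by (auto simp: S_def)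
    then have *: "x \<in> G (max m n)" "y \<in> G (max m n)"
      using mono[of m "max m n"] mono[of n "max m n"] by auto
    have "x \<squnion>\<^bsub>K\<^esub> y \<in> G (Suc (max m n))" "x \<sqinter>\<^bsub>K\<^esub> y \<in> G (Suc (max m n))"
      unfolding GSuc F_def using * by blast+
    then show "x \<squnion>\<^bsub>K\<^esub> y \<in> S" "x \<sqinter>\<^bsub>K\<^esub> y \<in> S" unfolding S_def by blast+
  qed
  moreover have "X \<subseteq> S" unfolding S_def using G0 by blast
  ultimately have "carrier K = S" using gen[of S] by simp
  then show ?thesis using count by (simp add: S_def)
qed

lemma lower_bounded_latticeD:
  fixes K :: "('k, 'n) gorder_scheme"
  assumes L: "lower_bounded_lattice L"
    and fg: "finitely_generated_lattice K"
    and hom: "lattice_hom K L f"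
  shows "lower_bounded_hom K L f"
proof -
  interpret K: lattice K using fg by (simp add: finitely_generated_lattice_def)
  define g where "g = to_nat_on (carrier K)"
  define h where "h = inv_into (carrier K) g"
  have inj: "inj_on g (carrier K)"
    unfolding g_def using finitely_generated_lattice_countable[OF fg] by (rule inj_on_to_nat_on)
  have hg: "h (g x) = x" if "x \<in> carrier K" for x
    unfolding h_def using inj that by simp
  define K' :: "nat gorder" where
    "K' = \<lparr>carrier = g ` carrier K, eq = (=), le = (\<lambda>i j. h i \<sqsubseteq>\<^bsub>K\<^esub> h j)\<rparr>"
  have carr: "carrier K' = g ` carrier K" by (simp add: K'_def)
  have le: "g x \<sqsubseteq>\<^bsub>K'\<^esub> g y \<longleftrightarrow> x \<sqsubseteq>\<^bsub>K\<^esub> y" if "x \<in> carrier K" "y \<in> carrier K" for x y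
    using that by (simp add: K'_def hg)
  interpret P: partial_order K'
  proof
    show "x .=\<^bsub>K'\<^esub> y"
      if A: "x \<sqsubseteq>\<^bsub>K'\<^esub> y" "y \<sqsubseteq>\<^bsub>K'\<^esub> x" "x \<in> carrier K'" "y \<in> carrier K'" for x y
    proof -
      obtain u v where uv: "u \<in> carrier K" "v \<in> carrier K" "x = g u" "y = g v"
        using A(3,4) unfolding carr by blast
      then have "u = v" using A(1,2) K.le_antisym by (simp add: le)
      then show ?thesis using uv by (simp add: K'_def)
    qed
    show "x \<sqsubseteq>\<^bsub>K'\<^esub> z" if A: "x \<sqsubseteq>\<^bsub>K'\<^esub> y" "y \<sqsubseteq>\<^bsub>K'\<^esub> z"
      "x \<in> carrier K'" "y \<in> carrier K'" "z \<in> carrier K'" for x y z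
    proof -
      obtain u v w where uvw: "u \<in> carrier K" "v \<in> carrier K" "w \<in> carrier K"
          "x = g u" "y = g v" "z = g w"
        using A(3-5) unfolding carr by blast
      then show ?thesis using A(1,2) K.le_trans[of u v w] by (simp add: le)
    qed
  qed (auto simp: K'_def hg)
  have lub: "is_lub K' (g (x \<squnion>\<^bsub>K\<^esub> y)) {g x, g y}" if "x \<in> carrier K" "y \<in> carrier K" for x y
    unfolding least_def Upper_def carr using that
    by (auto simp: le K.join_left K.join_right intro!: K.join_le)
  have glb: "is_glb K' (g (x \<sqinter>\<^bsub>K\<^esub> y)) {g x, g y}" if "x \<in> carrier K" "y \<in> carrier K" for x y
    unfolding greatest_def Lower_def carr using that
    by (auto simp: le K.meet_left K.meet_right intro!: K.meet_le)
  interpret K': lattice K'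
    by standard (auto simp: carr intro: lub glb)
  have join: "g x \<squnion>\<^bsub>K'\<^esub> g y = g (x \<squnion>\<^bsub>K\<^esub> y)" if "x \<in> carrier K" "y \<in> carrier K" for x y
    unfolding join_def[of K'] sup_def by (rule some_equality) (use lub[OF that] P.least_unique in blast)+
  have meet: "g x \<sqinter>\<^bsub>K'\<^esub> g y = g (x \<sqinter>\<^bsub>K\<^esub> y)" if "x \<in> carrier K" "y \<in> carrier K" for x y
    unfolding meet_def[of K'] inf_def by (rule some_equality) (use glb[OF that] P.greatest_unique in blast)+
  from fg obtain X where X: "finite X" "X \<subseteq> carrier K"
    and gen: "\<And>S. sublattice K S \<Longrightarrow> X \<subseteq> S \<Longrightarrow> S = carrier K"
    unfolding finitely_generated_lattice_def by (elim conjE exE) simp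
  have "S = carrier K'" if S: "sublattice K' S" "g ` X \<subseteq> S" for S
  proof -
    define T where "T = {x \<in> carrier K. g x \<in> S}"
    have "sublattice K T"
      using S(1) by (auto simp: sublattice_def T_def join[symmetric] meet[symmetric])
    moreover have "X \<subseteq> T" using S(2) X(2) by (auto simp: T_def)
    ultimately have "T = carrier K" by (rule gen)
    then show ?thesis using S(1) by (auto simp: T_def sublattice_def carr)
  qed
  then have fg': "finitely_generated_lattice K'"
    unfolding finitely_generated_lattice_def using X(1,2) K'.lattice_axioms
    by (intro conjI exI[of _ "g ` X"]) (auto simp: carr)
  have "lattice_hom K' L (f \<circ> h)"
    using hom K'.lattice_axioms
    by (auto simp: lattice_hom_def join_pres_def meet_pres_def carr join meet hg)
  with L fg' have lb: "lower_bounded_hom K' L (f \<circ> h)"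
    unfolding lower_bounded_lattice_def by blast
  show ?thesis
    unfolding lower_bounded_hom_def Let_def
  proof (intro conjI ballI hom)
    fix a assume a: "a \<in> carrier L"
    let ?P = "{x \<in> carrier K. a \<sqsubseteq>\<^bsub>L\<^esub> f x}" and ?Q = "{i \<in> carrier K'. a \<sqsubseteq>\<^bsub>L\<^esub> (f \<circ> h) i}"
    have Q: "?Q = g ` ?P" by (auto simp: carr hg)
    have "?Q = {} \<or> (\<exists>m. least K' m ?Q)"
      using lb a unfolding lower_bounded_hom_def Let_def by blast
    then show "?P = {} \<or> (\<exists>m. least K m ?P)"
    proof
      assume "\<exists>m. least K' m ?Q"
      then obtain m where "m \<in> ?P" "least K' (g m) (g ` ?P)" unfolding Q by (auto simp: least_def)
      then have "least K m ?P" by (auto simp: least_def le)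
      then show ?thesis by blast
    next
      assume "?Q = {}"
      then show ?thesis unfolding Q by blast
    qed
  qed
qed


section \<open>Embeddings\<close>

definition atom_embedding :: "('a, 'm) gorder_scheme \<Rightarrow> ('b, 'n) gorder_scheme \<Rightarrow> ('a \<Rightarrow> 'b) \<Rightarrow> bool" where
  "atom_embedding K L f \<longleftrightarrow> lattice_hom K L f \<and> inj_on f (carrier K) \<and>
     f \<bottom>\<^bsub>K\<^esub> = \<bottom>\<^bsub>L\<^esub> \<and> f \<top>\<^bsub>K\<^esub> = \<top>\<^bsub>L\<^esub> \<and> (\<forall>p. atom K p \<longrightarrow> atom L (f p))"

definition lattice_congruence :: "('a, 'm) gorder_scheme \<Rightarrow> ('a \<times> 'a) set \<Rightarrow> bool" where
  "lattice_congruence L \<theta> \<longleftrightarrow> equiv (carrier L) \<theta> \<and>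
     (\<forall>(x, x') \<in> \<theta>. \<forall>(y, y') \<in> \<theta>.
        (x \<squnion>\<^bsub>L\<^esub> y, x' \<squnion>\<^bsub>L\<^esub> y') \<in> \<theta> \<and> (x \<sqinter>\<^bsub>L\<^esub> y, x' \<sqinter>\<^bsub>L\<^esub> y') \<in> \<theta>)"

definition congruence_extension_property ::
    "('a, 'm) gorder_scheme \<Rightarrow> ('b, 'n) gorder_scheme \<Rightarrow> ('a \<Rightarrow> 'b) \<Rightarrow> bool" where
  "congruence_extension_property K L f \<longleftrightarrow>
     (\<forall>\<theta>. lattice_congruence K \<theta> \<longrightarrow>
        (\<exists>\<psi>. lattice_congruence L \<psi> \<and> \<theta> = inv_image \<psi> f \<inter> carrier K \<times> carrier K))"

definition solves_biatomicity_problems ::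
    "('a, 'm) gorder_scheme \<Rightarrow> ('b, 'n) gorder_scheme \<Rightarrow> ('a \<Rightarrow> 'b) \<Rightarrow> bool" where
  "solves_biatomicity_problems L L' f \<longleftrightarrow>
     (\<forall>p a b. atom L p \<and> a \<in> carrier L - {\<bottom>\<^bsub>L\<^esub>} \<and> b \<in> carrier L - {\<bottom>\<^bsub>L\<^esub>} \<and>
        p \<sqsubseteq>\<^bsub>L\<^esub> a \<squnion>\<^bsub>L\<^esub> b \<and> \<not> p \<sqsubseteq>\<^bsub>L\<^esub> a \<and> \<not> p \<sqsubseteq>\<^bsub>L\<^esub> b \<longrightarrow>
        (\<exists>x y. atom L' x \<and> atom L' y \<and> x \<sqsubseteq>\<^bsub>L'\<^esub> f a \<and> y \<sqsubseteq>\<^bsub>L'\<^esub> f b \<and>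
           f p \<sqsubseteq>\<^bsub>L'\<^esub> x \<squnion>\<^bsub>L'\<^esub> y))"

end

theory Submission
  imports Defs HOL.Hull
begin

text \<open>
  A finite atomistic lattice is the lattice of closed sets of a closure operator on its finite set
  \<open>S\<close> of atoms, in which the empty set and all singletons are closed; \<open>F\<close> denotes the family of
  closed sets and \<open>cl F\<close> the closure. Three properties of the lattice become properties of \<open>F\<close>.

  \<^item> A congruence is determined by the set \<open>T\<close> of atoms that it identifies with \<open>0\<close>: it identifies
    \<open>X\<close> and \<open>Y\<close> iff \<open>X - T = Y - T\<close>. The sets \<open>T\<close> that occur are those for which \<open>Y \<union> T\<close> is
    closed for every closed \<open>Y\<close> (\<open>congruence_set_of_congruence\<close>).
  \<^item> The lattice is join-semidistributive iff every closed set other than \<open>S\<close> stays closed after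
    adding a suitable point, that is, iff \<open>F\<close> is a convex geometry.
  \<^item> The lattice is lower bounded iff the family of congruence sets has the same property. A chain of
    congruence sets that grows by one point at a time orders the atoms in such a way that the
    relation ``\<open>q\<close> belongs to a minimal nontrivial join cover of \<open>p\<close>'' has no cycle. In one direction
    the chain allows one to construct least preimages atom by atom. In the other direction, let
    the free lattice on the elements of the lattice be mapped onto it; if every atom \<open>p\<close> has a least
    preimage, written as a term \<open>b p\<close> of minimal size, then Whitman's solution of the word problem
    shows that the sizes of these terms decrease along minimal join covers.

  Now let \<open>p \<le> a \<squnion> b\<close> be a biatomicity problem. Shrinking \<open>a\<close> and \<open>b\<close> one may assume that the
  pair is minimal. If \<open>a\<close> is not an atom, add one new point \<open>x\<close>. A closed set \<open>A\<close> stays closed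
  without \<open>x\<close> if it does not contain \<open>a\<close>, and it becomes closed together with \<open>x\<close> if
  \<open>b \<subseteq> cl F (insert p A)\<close> implies \<open>p \<in> A\<close>. The second condition is stronger than what
  \<open>p \<le> x \<squnion> b\<close> requires; it prevents \<open>p\<close> and a point of \<open>b\<close> from generating each other
  over a set that contains \<open>x\<close>, and so the new family is again a convex geometry. It is
  harmless for the old lattice, because in a convex geometry
  every closed set that contains \<open>a\<close> satisfies it (\<open>solvable_above\<close>). A congruence set \<open>T\<close> with
  \<open>p \<in> T\<close> extends by adding \<open>x\<close>. If \<open>p \<notin> T\<close>, minimality of \<open>(a, b)\<close> shows that neither \<open>a\<close> nor
  \<open>b\<close> becomes smaller modulo \<open>T\<close>, and \<open>T\<close> itself remains a congruence set. These two cases give the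
  congruence extension property and the preservation of lower boundedness.

  Doing this for \<open>(p, a, b)\<close> and then for \<open>(p, b, {x})\<close> produces both atoms that the problem asks for.
  Solved problems remain solved in later extensions, so that the finitely many problems
  of the given lattice can be treated one after the other.
\<close>

section \<open>Congruences of a closure system\<close>

abbreviation cl :: "'a set set \<Rightarrow> 'a set \<Rightarrow> 'a set" where
  "cl F C \<equiv> (\<lambda>X. X \<in> F) hull C"

lemma in_cl_iff: "x \<in> cl F C \<longleftrightarrow> (\<forall>X\<in>F. C \<subseteq> X \<longrightarrow> x \<in> X)"
  by (auto simp: hull_def)

lemma cl_least: "C \<subseteq> X \<Longrightarrow> X \<in> F \<Longrightarrow> cl F C \<subseteq> X"
  by (rule hull_minimal)

lemma cl_ident: "X \<in> F \<Longrightarrow> cl F X = X"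
  by (rule hull_same)

lemma cl_mono: "C \<subseteq> D \<Longrightarrow> cl F C \<subseteq> cl F D"
  by (rule hull_mono)

locale closed_sets =
  fixes S :: "'a set" and F :: "'a set set"
  assumes finite_points: "finite S"
    and closed_sub: "X \<in> F \<Longrightarrow> X \<subseteq> S"
    and closed_points: "S \<in> F"
    and closed_empty: "{} \<in> F"
    and closed_singleton: "s \<in> S \<Longrightarrow> {s} \<in> F"
    and closed_Int: "X \<in> F \<Longrightarrow> Y \<in> F \<Longrightarrow> X \<inter> Y \<in> F"
begin

lemma finite_closed: "finite F"
  using finite_points closed_sub by (meson PowI finite_Pow_iff finite_subset subsetI)

lemma closed_Inter: "\<lbrakk>G \<subseteq> F; G \<noteq> {}\<rbrakk> \<Longrightarrow> \<Inter>G \<in> F"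
proof -
  assume "G \<subseteq> F" "G \<noteq> {}"
  have "finite G" using \<open>G \<subseteq> F\<close> finite_closed finite_subset by blast
  then show ?thesis using \<open>G \<noteq> {}\<close> \<open>G \<subseteq> F\<close>
    by (induction G rule: finite_ne_induct) (auto intro: closed_Int)
qed

lemma cl_closed: "C \<subseteq> S \<Longrightarrow> cl F C \<in> F"
  unfolding hull_def using closed_points by (intro closed_Inter) auto

lemma cl_sub: "C \<subseteq> S \<Longrightarrow> cl F C \<subseteq> S"
  using cl_closed closed_sub by blast

lemma maximal_closed:
  assumes "X \<in> F" "P X"
  obtains Z where "Z \<in> F" "P Z" "X \<subseteq> Z" "\<And>W. W \<in> F \<Longrightarrow> P W \<Longrightarrow> Z \<subseteq> W \<Longrightarrow> W = Z"
proof -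
  have "finite {Z \<in> F. P Z}" using finite_closed by simp
  moreover have "X \<in> {Z \<in> F. P Z}" using assms by simp
  ultimately obtain Z where "Z \<in> {Z \<in> F. P Z}" "X \<subseteq> Z"
      "\<forall>W\<in>{Z \<in> F. P Z}. Z \<subseteq> W \<longrightarrow> Z = W"
    using finite_has_maximal2[of "{Z \<in> F. P Z}" X] by blast
  then show thesis by (intro that[of Z]) auto
qed

end

definition extendable :: "'a set \<Rightarrow> 'a set set \<Rightarrow> bool" where
  "extendable S G \<longleftrightarrow> (\<forall>X\<in>G. X \<noteq> S \<longrightarrow> (\<exists>q\<in>S - X. insert q X \<in> G))"

text \<open>
  These are the sets of atoms collapsed to \<open>0\<close> by the congruences of the lattice of closed sets.
  In terms of join covers: whenever a minimal set \<open>C\<close> with \<open>p \<in> cl F C\<close> meets \<open>T\<close>, then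
  \<open>p \<in> T\<close>.
\<close>

definition congruence_sets :: "'a set \<Rightarrow> 'a set set \<Rightarrow> 'a set set" where
  "congruence_sets S F = {T. T \<subseteq> S \<and> (\<forall>Y\<in>F. Y \<union> T \<in> F)}"

context closed_sets
begin

text \<open>
  A maximal closed set that meets \<open>W\<close> only in \<open>X\<close> can be enlarged by one point, and
  this point has to lie in \<open>W\<close>.
\<close>

lemma extend_within:
  assumes ext: "extendable S F" and X: "X \<in> F" and W: "W \<in> F" and "X \<subset> W"
  shows "\<exists>w\<in>W - X. insert w X \<in> F"
proof -
  obtain Z where Z: "Z \<in> F" "Z \<inter> W = X"
    and max: "\<And>V. V \<in> F \<Longrightarrow> V \<inter> W = X \<Longrightarrow> Z \<subseteq> V \<Longrightarrow> V = Z"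
    using maximal_closed[of X "\<lambda>Z. Z \<inter> W = X"] X \<open>X \<subset> W\<close> by (metis inf.absorb1 psubset_imp_subset)
  have "Z \<noteq> S" using Z \<open>X \<subset> W\<close> closed_sub[OF W] by blast
  then obtain q where q: "q \<in> S - Z" "insert q Z \<in> F"
    using ext Z(1) unfolding extendable_def by blast
  then have "insert q Z \<inter> W \<noteq> X" using max[of "insert q Z"] by blast
  then have "q \<in> W" using Z(2) by blast
  moreover from this have "insert q X = insert q Z \<inter> W" using Z(2) by blast
  ultimately show ?thesis using q closed_Int[OF q(2) W] Z(2) by auto
qed

lemma remove_within:
  assumes ext: "extendable S F" and X: "X \<in> F" and W: "W \<in> F" and "X \<subset> W"
  shows "\<exists>w\<in>W - X. W - {w} \<in> F"
proof -
  obtain Z where Z: "Z \<in> F" "Z \<subset> W" "X \<subseteq> Z"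
    and max: "\<And>V. V \<in> F \<Longrightarrow> V \<subset> W \<Longrightarrow> Z \<subseteq> V \<Longrightarrow> V = Z"
    using maximal_closed[of X "\<lambda>Z. Z \<subset> W"] X \<open>X \<subset> W\<close> by metis
  obtain w where w: "w \<in> W - Z" "insert w Z \<in> F"
    using extend_within[OF ext Z(1) W Z(2)] by blast
  then have "insert w Z = W" using max[of "insert w Z"] Z(2) by blast
  then have "W - {w} = Z" using w(1) by blast
  then show ?thesis using w(1) Z by blast
qed

text \<open>
  This is the anti-exchange property. A closed set that contains \<open>A\<close> and \<open>p\<close> contains the whole
  closure of \<open>insert p A\<close>, so the point of this closure that can be removed above \<open>A\<close>
  is \<open>p\<close> itself.
\<close>

lemma extreme_point:
  assumes ext: "extendable S F" and A: "A \<in> F" and p: "p \<in> S - A"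
  shows "cl F (insert p A) - {p} \<in> F"
proof -
  let ?W = "cl F (insert p A)"
  have sub: "insert p A \<subseteq> ?W" by (rule hull_subset)
  then have "A \<subset> ?W" using p by blast
  moreover have "?W \<in> F" using p closed_sub[OF A] by (intro cl_closed) blast
  ultimately obtain w where w: "w \<in> ?W - A" "?W - {w} \<in> F"
    using remove_within[OF ext A] by blast
  have "w = p"
  proof (rule ccontr)
    assume "w \<noteq> p"
    then have "?W \<subseteq> ?W - {w}" using sub w by (intro cl_least) auto
    then show False using w by blast
  qed
  then show ?thesis using w by simp
qed

lemma congruence_set_closed: "T \<in> congruence_sets S F \<Longrightarrow> T \<in> F"
  using closed_empty unfolding congruence_sets_def by force

lemma congruence_set_sub: "T \<in> congruence_sets S F \<Longrightarrow> T \<subseteq> S"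
  unfolding congruence_sets_def by force

lemma congruence_set_Un: "T \<in> congruence_sets S F \<Longrightarrow> Y \<in> F \<Longrightarrow> Y \<union> T \<in> F"
  unfolding congruence_sets_def by force

lemma empty_congruence_set: "{} \<in> congruence_sets S F"
  unfolding congruence_sets_def by auto

text \<open>
  Join covers may be thinned out modulo a congruence: the points outside \<open>T\<close> that \<open>C\<close> generates are
  already generated by the points of \<open>C\<close> outside \<open>T\<close>.
\<close>

lemma cl_Diff_congruence_set:
  assumes T: "T \<in> congruence_sets S F" and C: "C \<subseteq> S"
  shows "cl F C \<subseteq> cl F (C - T) \<union> T"
proof (rule cl_least)
  show "C \<subseteq> cl F (C - T) \<union> T" using hull_subset[of "C - T"] by blast
  show "cl F (C - T) \<union> T \<in> F" using C by (intro congruence_set_Un[OF T] cl_closed) blast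
qed

text \<open>
  Finite atomistic lower bounded lattices are join-semidistributive. Take a maximal congruence set
  \<open>T \<subseteq> X\<close> and enlarge it by a point \<open>q\<close>. By maximality \<open>q \<notin> X\<close>, and \<open>X \<union> insert q T\<close> is
  \<open>insert q X\<close>.
\<close>

lemma extendable_if_congruence_sets_extendable:
  assumes ext: "extendable S (congruence_sets S F)"
  shows "extendable S F"
  unfolding extendable_def
proof (intro ballI impI)
  fix X assume X: "X \<in> F" "X \<noteq> S"
  have "congruence_sets S F \<subseteq> F" using congruence_set_closed by blast
  then have "finite {T \<in> congruence_sets S F. T \<subseteq> X}"
    using finite_closed by (auto intro: finite_subset)
  moreover have "{} \<in> {T \<in> congruence_sets S F. T \<subseteq> X}" using empty_congruence_set by simp
  ultimately obtain T where T: "T \<in> congruence_sets S F" "T \<subseteq> X"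
    and max: "\<And>U. U \<in> congruence_sets S F \<Longrightarrow> U \<subseteq> X \<Longrightarrow> T \<subseteq> U \<Longrightarrow> U = T"
    using finite_has_maximal2[of "{T \<in> congruence_sets S F. T \<subseteq> X}" "{}"]
    by (smt (verit) mem_Collect_eq)
  have "T \<noteq> S" using T(2) X closed_sub by blast
  then obtain q where q: "q \<in> S - T" "insert q T \<in> congruence_sets S F"
    using ext T(1) unfolding extendable_def by blast
  then have "q \<notin> X" using max[of "insert q T"] T(2) by blast
  moreover have "X \<union> insert q T = insert q X" using T(2) by blast
  ultimately show "\<exists>q\<in>S - X. insert q X \<in> F" using q congruence_set_Un[OF q(2) X(1)] by auto
qed

end

text \<open>
  The lattice embedding belonging to an extension is \<open>cl F'\<close> restricted to \<open>F\<close>. The clauses make it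
  preserve the top element, joins, order, meets, and congruences, in this sequence; the bottom element
  and atoms are preserved because \<open>{}\<close> and the singletons are closed in both systems.
\<close>

definition extends :: "'a set \<Rightarrow> 'a set set \<Rightarrow> 'a set \<Rightarrow> 'a set set \<Rightarrow> bool" where
  "extends S F S' F' \<longleftrightarrow> S \<subseteq> S' \<and> cl F' S = S' \<and> (\<forall>X\<in>F'. X \<inter> S \<in> F) \<and>
     (\<forall>A\<in>F. cl F' A \<inter> S = A) \<and>
     (\<forall>A\<in>F. \<forall>B\<in>F. cl F' A \<inter> cl F' B \<subseteq> cl F' (A \<inter> B)) \<and>
     (\<forall>T\<in>congruence_sets S F. \<exists>T'\<in>congruence_sets S' F'. T' \<inter> S = T)"

section \<open>Adding one point below a join\<close>

text \<open>
  If \<open>a\<close> were a singleton \<open>{s}\<close>, a new point below \<open>a\<close> would destroy the atom \<open>{s}\<close>; in that case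
  \<open>s\<close> itself already serves as the point below \<open>a\<close>.
\<close>

locale unsolved_problem = closed_sets +
  fixes p :: 'a and a b :: "'a set" and x :: 'a
  assumes ext: "extendable S F"
    and p: "p \<in> S" "p \<notin> a" "p \<notin> b" "p \<in> cl F (a \<union> b)"
    and a: "a \<in> F" and b: "b \<in> F"
    and min_a: "\<And>a'. a' \<in> F \<Longrightarrow> a' \<subseteq> a \<Longrightarrow> p \<in> cl F (a' \<union> b) \<Longrightarrow> a' = a"
    and min_b: "\<And>b'. b' \<in> F \<Longrightarrow> b' \<subseteq> b \<Longrightarrow> p \<in> cl F (a \<union> b') \<Longrightarrow> b' = b"
    and not_singleton: "\<And>s. a \<noteq> {s}"
    and fresh: "x \<notin> S"
begin

abbreviation S' where "S' \<equiv> insert x S"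

text \<open>
  Solving the problem would only need \<open>p \<in> A\<close> when \<open>b \<subseteq> A\<close>. Under this weaker condition,
  suppose that a point \<open>q\<close> completes \<open>A\<close> to a set that contains \<open>b\<close>, and that \<open>A\<close> together
  with \<open>p\<close> generates \<open>b\<close> and \<open>q\<close>. Then \<open>p\<close> and \<open>q\<close> would generate each other over
  \<open>insert x A\<close>, which violates anti-exchange.
\<close>

definition F' :: "'a set set" where
  "F' = {A \<in> F. \<not> a \<subseteq> A} \<union> {insert x A | A. A \<in> F \<and> (b \<subseteq> cl F (insert p A) \<longrightarrow> p \<in> A)}"

lemma old_closed_iff: "A \<subseteq> S \<Longrightarrow> A \<in> F' \<longleftrightarrow> A \<in> F \<and> \<not> a \<subseteq> A"
  using fresh unfolding F'_def by blast

lemma new_closed_iff: "A \<subseteq> S \<Longrightarrow> insert x A \<in> F' \<longleftrightarrow> A \<in> F \<and> (b \<subseteq> cl F (insert p A) \<longrightarrow> p \<in> A)"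
proof
  assume A: "A \<subseteq> S" "insert x A \<in> F'"
  then obtain B where B: "insert x A = insert x B" "B \<in> F" "b \<subseteq> cl F (insert p B) \<longrightarrow> p \<in> B"
    using fresh closed_sub unfolding F'_def by blast
  moreover have "A = B" using B A(1) fresh closed_sub[OF B(2)] by (metis insert_ident subsetD)
  ultimately show "A \<in> F \<and> (b \<subseteq> cl F (insert p A) \<longrightarrow> p \<in> A)" by simp
qed (auto simp: F'_def)

lemma closed'_cases [consumes 1, case_names old new]:
  assumes "X \<in> F'"
  obtains "X \<in> F" "X \<subseteq> S" "\<not> a \<subseteq> X"
    | A where "X = insert x A" "A \<in> F" "A \<subseteq> S" "b \<subseteq> cl F (insert p A) \<longrightarrow> p \<in> A"
  using assms closed_sub unfolding F'_def by blast

lemma a_sub: "a \<subseteq> S" and b_sub: "b \<subseteq> S"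
  using a b closed_sub by auto

lemma p_in_closed: "A \<in> F \<Longrightarrow> a \<subseteq> A \<Longrightarrow> b \<subseteq> A \<Longrightarrow> p \<in> A"
  using p(4) cl_least[of "a \<union> b" A F] by blast

text \<open>
  Otherwise removing \<open>p\<close> from the closure of \<open>insert p A\<close> leaves a closed set that contains \<open>a\<close>
  and \<open>b\<close>, hence \<open>p\<close>. This fact makes \<open>insert x A\<close> closed whenever \<open>a \<subseteq> A\<close>.
\<close>

lemma solvable_above:
  assumes A: "A \<in> F" and aA: "a \<subseteq> A" and bA: "b \<subseteq> cl F (insert p A)"
  shows "p \<in> A"
proof (rule ccontr)
  assume "p \<notin> A"
  then have "cl F (insert p A) - {p} \<in> F" using extreme_point[OF ext A] p(1) by blast
  moreover have "a \<subseteq> cl F (insert p A) - {p}"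
    using aA p(2) hull_subset[of "insert p A" "\<lambda>X. X \<in> F"] by blast
  ultimately show False using p_in_closed[of "cl F (insert p A) - {p}"] bA p(3) by blast
qed

lemma closed_sets': "closed_sets S' F'"
proof
  show "finite S'" using finite_points by simp
  show "X \<subseteq> S'" if "X \<in> F'" for X using that by (cases rule: closed'_cases) auto
  show "S' \<in> F'" using p(1) closed_points by (simp add: new_closed_iff)
  have "\<not> a \<subseteq> {}" using p(3,4) cl_ident[OF b] by auto
  then show "{} \<in> F'" using closed_empty by (simp add: old_closed_iff)
  have "b \<noteq> {}" using p(2,4) cl_ident[OF a] by auto
  show "{s} \<in> F'" if "s \<in> S'" for s
  proof (cases "s = x")
    case True
    have "\<not> b \<subseteq> {p}" using \<open>b \<noteq> {}\<close> p(3) by blast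
    then show ?thesis using True new_closed_iff[of "{}"] closed_empty cl_ident[OF closed_singleton[OF p(1)]] by simp
  next
    case False
    then have "s \<in> S" using that by simp
    moreover have "\<not> a \<subseteq> {s}" using \<open>\<not> a \<subseteq> {}\<close> not_singleton[of s] by blast
    ultimately show ?thesis using closed_singleton by (simp add: old_closed_iff)
  qed
  show "X \<inter> Y \<in> F'" if "X \<in> F'" "Y \<in> F'" for X Y
    using that(1)
  proof (cases rule: closed'_cases)
    case old
    from that(2) show ?thesis
    proof (cases rule: closed'_cases)
      case old': old
      have "X \<inter> Y \<in> F" using old old' closed_Int by blast
      then show ?thesis using old by (simp add: F'_def)
    next
      case (new B)
      have "X \<inter> Y = X \<inter> B" using old new fresh by blast
      moreover have "X \<inter> B \<in> F" using old new closed_Int by blast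
      ultimately show ?thesis using old by (simp add: F'_def)
    qed
  next
    case (new A)
    from that(2) show ?thesis
    proof (cases rule: closed'_cases)
      case old
      have "X \<inter> Y = A \<inter> Y" using old new fresh by blast
      moreover have "A \<inter> Y \<in> F" using old new closed_Int by blast
      ultimately show ?thesis using old by (simp add: F'_def)
    next
      case new': (new B)
      have "X \<inter> Y = insert x (A \<inter> B)" using new new' by blast
      moreover have "b \<subseteq> cl F (insert p (A \<inter> B)) \<longrightarrow> p \<in> A \<inter> B"
        using new(4) new'(4) cl_mono[of "insert p (A \<inter> B)" "insert p A" F]
          cl_mono[of "insert p (A \<inter> B)" "insert p B" F] by blast
      ultimately show ?thesis using closed_Int[OF new(2) new'(2)] unfolding F'_def by auto
    qed
  qed
qed

sublocale new: closed_sets S' F' by (rule closed_sets')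

lemma cl_old:
  assumes "A \<in> F"
  shows "cl F' A = (if a \<subseteq> A then insert x A else A)"
proof (cases "a \<subseteq> A")
  case True
  then have "insert x A \<in> F'"
    using assms solvable_above closed_sub by (simp add: new_closed_iff)
  moreover have "insert x A \<subseteq> X" if "X \<in> F'" "A \<subseteq> X" for X
    using that(1) by (cases rule: closed'_cases) (use True that fresh in auto)
  ultimately show ?thesis using True cl_least[of A "insert x A" F'] in_cl_iff[of _ F' A] by auto
next
  case False
  then have "A \<in> F'" using assms closed_sub by (simp add: old_closed_iff)
  then show ?thesis using False cl_ident by auto
qed

lemma x_in_cl: "x \<in> cl F' a"
  using cl_old[OF a] by simp

lemma solved': "p \<in> cl F' (insert x b)"
  unfolding in_cl_iff
proof (intro ballI impI)
  fix X assume "X \<in> F'" "insert x b \<subseteq> X"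
  then show "p \<in> X"
  proof (cases rule: closed'_cases)
    case (new A)
    then have "b \<subseteq> A" using \<open>insert x b \<subseteq> X\<close> b_sub fresh by auto
    then have "b \<subseteq> cl F (insert p A)" using hull_subset[of "insert p A" "\<lambda>X. X \<in> F"] by blast
    then show ?thesis using new by blast
  qed (use fresh in blast)
qed

text \<open>
  A closed set \<open>insert x A\<close> grows inside the closure of \<open>insert p A\<close> as long as it does not contain
  \<open>p\<close>, which keeps \<open>b\<close> out of reach. A closed set \<open>X\<close> without \<open>x\<close> is enlarged by \<open>x\<close> if possible;
  if not, then \<open>b\<close> lies below the join of \<open>X\<close> and \<open>p\<close>, so the closed set obtained from this
  join by removing \<open>p\<close> does not contain \<open>a\<close>, and there is room to grow inside it or, if \<open>X\<close>
  already equals it, by \<open>p\<close>.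
\<close>

lemma extendable': "extendable S' F'"
  unfolding extendable_def
proof (intro ballI impI)
  fix X assume X: "X \<in> F'" "X \<noteq> S'"
  from X(1) show "\<exists>q\<in>S' - X. insert q X \<in> F'"
  proof (cases rule: closed'_cases)
    case (new A)
    then have "A \<noteq> S" using X(2) by blast
    show ?thesis
    proof (cases "p \<in> A")
      case True
      obtain q where q: "q \<in> S - A" "insert q A \<in> F"
        using ext new(2) \<open>A \<noteq> S\<close> unfolding extendable_def by blast
      then have "insert x (insert q A) \<in> F'" using True new by (simp add: new_closed_iff)
      then show ?thesis using q new fresh by (intro bexI[of _ q]) (auto simp: insert_commute)
    next
      case False
      let ?W = "cl F (insert p A)"
      have W: "?W \<in> F" using p(1) new(3) by (intro cl_closed) auto
      have pAW: "insert p A \<subseteq> ?W" by (rule hull_subset)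
      then have "A \<subset> ?W" using False by blast
      then obtain q where q: "q \<in> ?W - A" "insert q A \<in> F"
        using extend_within[OF ext new(2) W] by blast
      have "q \<in> S" using q(1) closed_sub[OF W] by blast
      have "cl F (insert p (insert q A)) \<subseteq> ?W"
        using q(1) pAW W by (intro cl_least) (simp_all add: insert_commute)
      then have "insert x (insert q A) \<in> F'"
        using False new q \<open>q \<in> S\<close> by (auto simp: new_closed_iff)
      then show ?thesis using q new fresh \<open>q \<in> S\<close> by (intro bexI[of _ q]) (auto simp: insert_commute)
    qed
  next
    case old
    show ?thesis
    proof (cases "insert x X \<in> F'")
      case True
      then show ?thesis using old fresh by blast
    next
      case False
      let ?W = "cl F (insert p X)"
      have bW: "b \<subseteq> ?W" "p \<notin> X" using False old by (auto simp: new_closed_iff)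
      have W: "?W \<in> F" using p(1) old(2) by (intro cl_closed) auto
      have V: "?W - {p} \<in> F" using extreme_point[OF ext old(1)] p(1) bW by blast
      have XV: "X \<subseteq> ?W - {p}" using bW(2) hull_subset[of "insert p X" "\<lambda>X. X \<in> F"] by blast
      have aV: "\<not> a \<subseteq> ?W - {p}" using p_in_closed[OF V] bW p(3) by blast
      have "\<exists>q\<in>S - X. insert q X \<in> F \<and> \<not> a \<subseteq> insert q X"
      proof (cases "X = ?W - {p}")
        case True
        then have "insert p X = ?W" using hull_subset[of "insert p X" "\<lambda>X. X \<in> F"] by blast
        then have "insert p X \<in> F" using W by simp
        moreover have "\<not> a \<subseteq> insert p X" using old(3) p(2) by blast
        ultimately show ?thesis using p(1) bW(2) by blast
      next
        case False
        then obtain q where q: "q \<in> ?W - {p} - X" "insert q X \<in> F"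
          using extend_within[OF ext old(1) V] XV by blast
        moreover have "\<not> a \<subseteq> insert q X" using aV q(1) XV by blast
        ultimately show ?thesis using closed_sub[OF V] by blast
      qed
      then obtain q where "q \<in> S - X" "insert q X \<in> F" "\<not> a \<subseteq> insert q X" by blast
      then show ?thesis using fresh by (auto simp: F'_def intro!: bexI[of _ q])
    qed
  qed
qed

text \<open>
  If \<open>T\<close> does not collapse \<open>p\<close>, then \<open>p\<close> is below the join of the parts of \<open>a\<close> and \<open>b\<close> generated
  outside \<open>T\<close>; by minimality of the pair these parts are everything.
\<close>

lemma minimal_avoids:
  assumes T: "T \<in> congruence_sets S F" and "p \<notin> T"
  shows "cl F (a - T) = a" "cl F (b - T) = b"
proof -
  have sub: "cl F (a - T) \<subseteq> a" "cl F (b - T) \<subseteq> b" by (intro cl_least a b Diff_subset)+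
  have cls: "cl F (a - T) \<in> F" "cl F (b - T) \<in> F" using a_sub b_sub by (auto intro!: cl_closed)
  have "p \<in> cl F (a \<union> b - T)"
    using cl_Diff_congruence_set[OF T, of "a \<union> b"] a_sub b_sub p(4) \<open>p \<notin> T\<close> by blast
  moreover have "a \<union> b - T \<subseteq> cl F (a - T) \<union> b" "a \<union> b - T \<subseteq> a \<union> cl F (b - T)"
    using hull_subset[of "a - T" "\<lambda>X. X \<in> F"] hull_subset[of "b - T" "\<lambda>X. X \<in> F"] by blast+
  ultimately have "p \<in> cl F (cl F (a - T) \<union> b)" "p \<in> cl F (a \<union> cl F (b - T))"
    using cl_mono by blast+
  then show "cl F (a - T) = a" "cl F (b - T) = b" using sub cls min_a min_b by auto
qed

lemma congruence_set_without:
  assumes T: "T \<in> congruence_sets S F" and aT: "cl F (a - T) = a"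
  shows "T \<in> congruence_sets S' F'"
  unfolding congruence_sets_def
proof (intro CollectI conjI ballI)
  have TS: "T \<subseteq> S" using T by (rule congruence_set_sub)
  then show "T \<subseteq> S'" by blast
  fix Y assume "Y \<in> F'"
  then show "Y \<union> T \<in> F'"
  proof (cases rule: closed'_cases)
    case old
    have "\<not> a \<subseteq> Y \<union> T" using old cl_least[of "a - T" Y F] aT by blast
    then show ?thesis using old TS congruence_set_Un[OF T] by (simp add: old_closed_iff)
  next
    case (new A)
    have "p \<in> A \<union> T" if "b \<subseteq> cl F (insert p (A \<union> T))"
    proof (rule ccontr)
      assume "p \<notin> A \<union> T"
      have W: "cl F (insert p A) \<in> F" using p(1) new by (intro cl_closed) auto
      have "cl F (insert p (A \<union> T)) \<subseteq> cl F (insert p A) \<union> T"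
        using hull_subset[of "insert p A" "\<lambda>X. X \<in> F"]
        by (intro cl_least congruence_set_Un[OF T W]) blast
      then have "b - T \<subseteq> cl F (insert p A)" using that by blast
      then have "b \<subseteq> cl F (insert p A)"
        using cl_least[OF _ W, of "b - T"] minimal_avoids(2)[OF T] \<open>p \<notin> A \<union> T\<close> by blast
      then show False using new \<open>p \<notin> A \<union> T\<close> by blast
    qed
    then have "insert x (A \<union> T) \<in> F'"
      using new TS congruence_set_Un[OF T new(2)] by (simp add: new_closed_iff)
    then show ?thesis using new by simp
  qed
qed

lemma congruence_set_with:
  assumes T: "T \<in> congruence_sets S F" and "p \<in> T"
  shows "insert x T \<in> congruence_sets S' F'"
  unfolding congruence_sets_def
proof (intro CollectI conjI ballI)
  have TS: "T \<subseteq> S" using T by (rule congruence_set_sub)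
  then show "insert x T \<subseteq> S'" by blast
  fix Y assume "Y \<in> F'"
  then obtain A where A: "A \<in> F" "A \<subseteq> S" "insert x Y = insert x A"
    by (cases rule: closed'_cases) auto
  have "insert x (A \<union> T) \<in> F'"
    using A TS congruence_set_Un[OF T A(1)] \<open>p \<in> T\<close> by (simp add: new_closed_iff)
  moreover have "Y \<union> insert x T = insert x (A \<union> T)" using A(3) by blast
  ultimately show "Y \<union> insert x T \<in> F'" by simp
qed

lemma trace_closed:
  assumes "X \<in> F'"
  shows "X \<inter> S \<in> F"
  using assms
proof (cases rule: closed'_cases)
  case old
  then show ?thesis by (simp add: Int_absorb2)
next
  case (new A)
  then have "X \<inter> S = A" using fresh by blast
  then show ?thesis using new by simp
qed

lemma cl_old_Int: "A \<in> F \<Longrightarrow> cl F' A \<inter> S = A"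
  using cl_old closed_sub fresh by auto

lemma congruence_set_trace:
  assumes T: "T \<in> congruence_sets S' F'"
  shows "T \<inter> S \<in> congruence_sets S F"
  unfolding congruence_sets_def
proof (intro CollectI conjI ballI)
  fix Y assume Y: "Y \<in> F"
  then have "cl F' Y \<in> F'" using closed_sub by (intro new.cl_closed) auto
  then have "(cl F' Y \<union> T) \<inter> S \<in> F" using new.congruence_set_Un[OF T] trace_closed by blast
  then show "Y \<union> T \<inter> S \<in> F" using cl_old_Int[OF Y] by (simp add: Int_Un_distrib2)
qed simp

lemma extends': "extends S F S' F'"
  unfolding extends_def
proof (intro conjI ballI)
  show "cl F' S = S'" using cl_old[OF closed_points] a_sub by simp
  fix T assume T: "T \<in> congruence_sets S F"
  show "\<exists>T'\<in>congruence_sets S' F'. T' \<inter> S = T"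
  proof (cases "p \<in> T")
    case True
    then show ?thesis using congruence_set_with[OF T] congruence_set_sub[OF T] fresh
      by (intro bexI[of _ "insert x T"]) auto
  next
    case False
    then show ?thesis
      using congruence_set_without[OF T] minimal_avoids(1)[OF T] congruence_set_sub[OF T]
      by (intro bexI[of _ T]) auto
  qed
next
  fix A B assume "A \<in> F" "B \<in> F"
  moreover from this have "x \<notin> A" "x \<notin> B" using closed_sub fresh by auto
  ultimately show "cl F' A \<inter> cl F' B \<subseteq> cl F' (A \<inter> B)" using closed_Int by (auto simp: cl_old)
qed (use trace_closed cl_old_Int in auto)

text \<open>
  A congruence set \<open>U\<close> of the new system is \<open>T\<close> or \<open>insert x T\<close> for a congruence set \<open>T\<close> of the old
  one. In the second case \<open>p \<in> T\<close>, so any old enlargement of \<open>T\<close> works. In the first case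
  \<open>x\<close> is added if \<open>p \<in> T\<close>. Otherwise \<open>T\<close> is enlarged as in the old system by some \<open>q\<close>: either
  \<open>p\<close> is still avoided, or \<open>q = p\<close>, which does not affect \<open>a\<close> because \<open>p \<notin> a\<close>.
\<close>

lemma congruence_sets_extendable':
  assumes con: "extendable S (congruence_sets S F)"
  shows "extendable S' (congruence_sets S' F')"
  unfolding extendable_def
proof (intro ballI impI)
  fix U assume U: "U \<in> congruence_sets S' F'" "U \<noteq> S'"
  define T where "T = U \<inter> S"
  have T: "T \<in> congruence_sets S F" unfolding T_def using congruence_set_trace[OF U(1)] .
  have TS: "T \<subseteq> S" by (simp add: T_def)
  show "\<exists>q\<in>S' - U. insert q U \<in> congruence_sets S' F'"
  proof (cases "x \<in> U")
    case True
    then have UT: "U = insert x T" using new.congruence_set_sub[OF U(1)] by (auto simp: T_def)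
    then have "T \<noteq> S" using U(2) by blast
    then obtain q where q: "q \<in> S - T" "insert q T \<in> congruence_sets S F"
      using con T unfolding extendable_def by blast
    \<comment> \<open>The old closed set \<open>b\<close> is still closed, so \<open>b \<union> U\<close> is closed; it contains \<open>x\<close> and \<open>b\<close>, and therefore \<open>p\<close>.\<close>
    have "\<not> a \<subseteq> b" using p_in_closed[OF b] p(3) by blast
    then have "b \<in> F'" using b b_sub by (simp add: old_closed_iff)
    then have "b \<union> U \<in> F'" using new.congruence_set_Un[OF U(1)] by blast
    moreover have "insert x b \<subseteq> b \<union> U" using True by blast
    ultimately have "p \<in> b \<union> U" using solved' cl_least[of "insert x b" "b \<union> U" F'] by blast
    then have "p \<in> T" using p by (simp add: T_def)
    then have "insert x (insert q T) \<in> congruence_sets S' F'"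
      using congruence_set_with[OF q(2)] by simp
    then show ?thesis using q UT fresh by (intro bexI[of _ q]) (auto simp: insert_commute)
  next
    case False
    then have UT: "U = T" using new.congruence_set_sub[OF U(1)] by (auto simp: T_def)
    show ?thesis
    proof (cases "p \<in> T")
      case True
      then show ?thesis using congruence_set_with[OF T] UT fresh TS by blast
    next
      case pT: False
      then have "T \<noteq> S" using p(1) by blast
      then obtain q where q: "q \<in> S - T" "insert q T \<in> congruence_sets S F"
        using con T unfolding extendable_def by blast
      have "cl F (a - insert q T) = a"
      proof (cases "q = p")
        case True
        then have "a - insert q T = a - T" using p(2) by blast
        then show ?thesis using minimal_avoids(1)[OF T pT] by simp
      next
        case False
        then show ?thesis using minimal_avoids(1)[OF q(2)] pT by blast
      qed
      then show ?thesis using congruence_set_without[OF q(2)] UT q by blast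
    qed
  qed
qed

end

section \<open>Solving all biatomicity problems\<close>

text \<open>
  Preservation of lower boundedness is an implication, so that a single construction serves both
  halves of the theorem.
\<close>

definition good_extension where
  "good_extension S F S' F' \<longleftrightarrow> closed_sets S' F' \<and> extends S F S' F' \<and> extendable S' F' \<and>
     (extendable S (congruence_sets S F) \<longrightarrow> extendable S' (congruence_sets S' F'))"

lemma
  assumes "extends S F S' F'"
  shows extends_sub: "S \<subseteq> S'"
    and extends_points: "cl F' S = S'"
    and extends_trace: "X \<in> F' \<Longrightarrow> X \<inter> S \<in> F"
    and extends_cl_trace: "A \<in> F \<Longrightarrow> cl F' A \<inter> S = A"
    and extends_cl_Int: "A \<in> F \<Longrightarrow> B \<in> F \<Longrightarrow> cl F' A \<inter> cl F' B \<subseteq> cl F' (A \<inter> B)"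
    and extends_congruence_set:
      "T \<in> congruence_sets S F \<Longrightarrow> \<exists>T'\<in>congruence_sets S' F'. T' \<inter> S = T"
  using assms by (simp_all add: extends_def)

text \<open>
  Closing in a smaller system first does not change the closure in a larger one; in particular,
  the embeddings of successive extensions compose.
\<close>

lemma cl_cl_extends:
  assumes "closed_sets S F" "closed_sets S' F'" "extends S F S' F'" "extends S' F' S'' F''" "C \<subseteq> S"
  shows "cl F'' (cl F C) = cl F'' C" and "cl F'' (cl F' C) = cl F'' C"
proof -
  interpret closed_sets S F by fact
  interpret F': closed_sets S' F' by fact
  have "cl F C \<subseteq> X" "cl F' C \<subseteq> X" if X: "X \<in> F''" "C \<subseteq> X" for X
  proof -
    have 1: "X \<inter> S' \<in> F'" and 2: "S \<subseteq> S'"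
      using extends_trace[OF assms(4)] extends_sub[OF assms(3)] X by auto
    then show "cl F' C \<subseteq> X" using X \<open>C \<subseteq> S\<close> cl_least[of C "X \<inter> S'" F'] by blast
    have "X \<inter> S' \<inter> S \<in> F" using extends_trace[OF assms(3) 1] .
    then show "cl F C \<subseteq> X" using X \<open>C \<subseteq> S\<close> 2 cl_least[of C "X \<inter> S' \<inter> S" F] by blast
  qed
  then show "cl F'' (cl F C) = cl F'' C" "cl F'' (cl F' C) = cl F'' C"
    using hull_subset[of C "\<lambda>X. X \<in> F"] hull_subset[of C "\<lambda>X. X \<in> F'"]
    unfolding hull_def[of "\<lambda>X. X \<in> F''"] by (metis (no_types, lifting) subset_trans)+
qed

lemma extends_refl: "closed_sets S F \<Longrightarrow> extends S F S F"
proof -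
  assume "closed_sets S F"
  then interpret closed_sets S F .
  show ?thesis unfolding extends_def
    using closed_sub closed_points congruence_set_sub closed_Int
    by (auto simp: cl_ident Int_absorb2)
qed

lemma extends_trans:
  assumes "closed_sets S F" "closed_sets S' F'" and 1: "extends S F S' F'" and 2: "extends S' F' S'' F''"
  shows "extends S F S'' F''"
proof -
  interpret closed_sets S F by fact
  interpret F': closed_sets S' F' by fact
  have SS: "S \<subseteq> S'" "S' \<subseteq> S''" using extends_sub 1 2 by blast+
  have cc: "cl F'' C = cl F'' (cl F' C)" if "C \<subseteq> S" for C
    using cl_cl_extends(2)[OF assms that] by simp
  have cl': "cl F' A \<in> F'" if "A \<in> F" for A using that closed_sub SS by (intro F'.cl_closed) blast
  show ?thesis unfolding extends_def
  proof (intro conjI ballI)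
    show "S \<subseteq> S''" using SS by blast
    show "cl F'' S = S''" using cc[of S] extends_points[OF 1] extends_points[OF 2] by simp
    show "X \<inter> S \<in> F" if "X \<in> F''" for X
    proof -
      have "X \<inter> S' \<inter> S \<in> F" using that extends_trace 1 2 by blast
      moreover have "X \<inter> S' \<inter> S = X \<inter> S" using SS by blast
      ultimately show ?thesis by simp
    qed
    show "cl F'' A \<inter> S = A" if "A \<in> F" for A
    proof -
      have "cl F'' A \<inter> S' = cl F' A" 
        using extends_cl_trace[OF 2 cl'[OF that]] cc[OF closed_sub[OF that]] by simp
      moreover have "cl F' A \<inter> S = A" using extends_cl_trace[OF 1 that] .
      ultimately show ?thesis using SS by blast
    qed
    show "cl F'' A \<inter> cl F'' B \<subseteq> cl F'' (A \<inter> B)" if "A \<in> F" "B \<in> F" for A B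
    proof -
      have "cl F'' (cl F' A) \<inter> cl F'' (cl F' B) \<subseteq> cl F'' (cl F' A \<inter> cl F' B)"
        using extends_cl_Int[OF 2 cl' cl'] that by blast
      also have "\<dots> \<subseteq> cl F'' (cl F' (A \<inter> B))"
        using extends_cl_Int[OF 1 that] by (rule cl_mono)
      finally show ?thesis using cc that closed_sub by (metis closed_Int)
    qed
    show "\<exists>T'\<in>congruence_sets S'' F''. T' \<inter> S = T" if T: "T \<in> congruence_sets S F" for T
    proof -
      obtain T' where T': "T' \<in> congruence_sets S' F'" "T' \<inter> S = T"
        using extends_congruence_set[OF 1 T] by blast
      then obtain T'' where "T'' \<in> congruence_sets S'' F''" "T'' \<inter> S' = T'"
        using extends_congruence_set[OF 2] by blast
      then show ?thesis using T' SS by (intro bexI[of _ T'']) auto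
    qed
  qed
qed

lemma good_extension_trans:
  assumes "closed_sets S F" "good_extension S F S' F'" "good_extension S' F' S'' F''"
  shows "good_extension S F S'' F''"
  using assms extends_trans[of S F S' F' S'' F''] unfolding good_extension_def by blast

lemma good_extension_refl:
  assumes "closed_sets S F" "extendable S F"
  shows "good_extension S F S F"
  using assms extends_refl unfolding good_extension_def by blast

text \<open>
  The pair is made minimal by minimizing the total number of points. Solving the smaller problem
  solves the given one because closures are monotone.
\<close>

lemma one_sided_solution:
  fixes S :: "'a set"
  assumes "closed_sets S F" "extendable S F" "infinite (UNIV :: 'a set)"
    and A: "A \<in> F" and B: "B \<in> F" and p: "p \<in> S" "p \<in> cl F (A \<union> B)" "p \<notin> A" "p \<notin> B"
  obtains S' F' x where "good_extension S F S' F'" "x \<in> cl F' A" "p \<in> cl F' (insert x B)"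
proof -
  interpret closed_sets S F by fact
  define Q where "Q = {(a, b). a \<in> F \<and> b \<in> F \<and> a \<subseteq> A \<and> b \<subseteq> B \<and> p \<in> cl F (a \<union> b)}"
  have "(A, B) \<in> Q" using A B p unfolding Q_def by simp
  then obtain a b where ab: "(a, b) \<in> Q"
    and min: "\<And>a' b'. (a', b') \<in> Q \<Longrightarrow> card a + card b \<le> card a' + card b'"
    using ex_has_least_nat[of "\<lambda>z. z \<in> Q" "(A, B)" "\<lambda>z. card (fst z) + card (snd z)"]
    by (metis fst_conv snd_conv surj_pair)
  have abF: "a \<in> F" "b \<in> F" using ab unfolding Q_def by auto
  then have fin: "finite a" "finite b" using finite_subset[OF closed_sub finite_points] by auto
  have min_a: "a' = a" if "a' \<in> F" "a' \<subseteq> a" "p \<in> cl F (a' \<union> b)" for a'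
  proof -
    have "(a', b) \<in> Q" using ab that unfolding Q_def by auto
    from min[OF this] show ?thesis using card_seteq[OF fin(1) that(2)] by simp
  qed
  have min_b: "b' = b" if "b' \<in> F" "b' \<subseteq> b" "p \<in> cl F (a \<union> b')" for b'
  proof -
    have "(a, b') \<in> Q" using ab that unfolding Q_def by auto
    from min[OF this] show ?thesis using card_seteq[OF fin(2) that(2)] by simp
  qed
  have sub: "a \<subseteq> A" "b \<subseteq> B" using ab unfolding Q_def by auto
  show thesis
  proof (cases "\<exists>s. a = {s}")
    case True
    then obtain s where s: "a = {s}" ..
    have "a \<union> b \<subseteq> insert s B" using s sub by blast
    then have "p \<in> cl F (insert s B)" using ab cl_mono unfolding Q_def by blast
    moreover have "s \<in> cl F A" using s sub hull_subset[of A "\<lambda>X. X \<in> F"] by blast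
    ultimately show thesis using that good_extension_refl assms by blast
  next
    case False
    obtain x where x: "x \<notin> S" using assms(3) finite_points ex_new_if_finite by blast
    interpret step: unsolved_problem S F p a b x
      by standard (use assms ab False x min_a min_b in \<open>auto simp: Q_def\<close>)
    show thesis
    proof (rule that)
      show "good_extension S F step.S' step.F'"
        unfolding good_extension_def
        using step.closed_sets' step.extends' step.extendable' step.congruence_sets_extendable' by blast
      show "x \<in> cl step.F' A" using step.x_in_cl cl_mono[OF sub(1)] by blast
      show "p \<in> cl step.F' (insert x B)" using step.solved' cl_mono[of "insert x b" "insert x B"] sub by blast
    qed
  qed
qed

definition solved where
  "solved F p A B \<longleftrightarrow> (\<exists>x\<in>cl F A. \<exists>y\<in>cl F B. p \<in> cl F {x, y})"

lemma solved_extends: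
  assumes "closed_sets S F" "closed_sets S' F'" "extends S F S' F'" "extends S' F' S'' F''"
    and "A \<subseteq> S" "B \<subseteq> S" "solved F' p A B"
  shows "solved F'' p A B"
proof -
  interpret F': closed_sets S' F' by fact
  have SS: "S \<subseteq> S'" using extends_sub[OF assms(3)] .
  obtain x y where xy: "x \<in> cl F' A" "y \<in> cl F' B" "p \<in> cl F' {x, y}"
    using assms unfolding solved_def by blast
  have mono: "cl F' C \<subseteq> cl F'' C" if "C \<subseteq> S'" for C
    using cl_cl_extends(1)[OF assms(2,2) extends_refl[OF assms(2)] assms(4) that]
      hull_subset[of "cl F' C"] by blast
  have "{x, y} \<subseteq> S'" using xy F'.cl_sub assms SS by blast
  then show ?thesis
    using xy mono[of A] mono[of B] mono[of "{x, y}"] assms(5,6) SS unfolding solved_def by blast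
qed

text \<open>
  The second application has the roles of \<open>A\<close> and \<open>B\<close> exchanged, with \<open>A\<close> replaced by the atom
  \<open>{x}\<close> found in the first one.
\<close>

lemma solution:
  fixes S :: "'a set"
  assumes S: "closed_sets S F" and ext: "extendable S F" and inf: "infinite (UNIV :: 'a set)"
    and A: "A \<in> F" and B: "B \<in> F" and p: "p \<in> S" "p \<in> cl F (A \<union> B)" "p \<notin> A" "p \<notin> B"
  obtains S' F' where "good_extension S F S' F'" "solved F' p A B"
proof -
  interpret closed_sets S F by fact
  obtain S1 F1 x where 1: "good_extension S F S1 F1" "x \<in> cl F1 A" "p \<in> cl F1 (insert x B)"
    using one_sided_solution[OF assms] by blast
  then interpret F1: closed_sets S1 F1 unfolding good_extension_def by blast
  have ext1: "extends S F S1 F1" "extendable S1 F1" using 1 unfolding good_extension_def by auto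
  then have S1: "S \<subseteq> S1" using extends_sub by blast
  have A1: "A \<subseteq> S1" and B1: "B \<subseteq> S1" using A B closed_sub S1 by blast+
  have "x \<in> S1" using 1(2) F1.cl_sub[OF A1] by blast
  then have x1: "{x} \<in> F1" by (rule F1.closed_singleton)
  have trace: "cl F1 A \<inter> S = A" "cl F1 B \<inter> S = B" using extends_cl_trace[OF ext1(1)] A B by auto
  have "insert x B \<subseteq> cl F1 B \<union> {x}" using hull_subset[of B "\<lambda>X. X \<in> F1"] by blast
  then have "p \<in> cl F1 (cl F1 B \<union> {x})" using 1(3) cl_mono by blast
  moreover have "p \<noteq> x" using 1(2) trace p by blast
  moreover have "p \<notin> cl F1 B" using trace p by blast
  ultimately obtain S2 F2 y where 2: "good_extension S1 F1 S2 F2" "y \<in> cl F2 (cl F1 B)"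
      "p \<in> cl F2 (insert y {x})"
    using one_sided_solution[OF F1.closed_sets_axioms ext1(2) inf F1.cl_closed[OF B1] x1, of p] p S1 by blast
  have ext2: "extends S1 F1 S2 F2" using 2 unfolding good_extension_def by auto
  note cc = cl_cl_extends(2)[OF F1.closed_sets_axioms F1.closed_sets_axioms
      extends_refl[OF F1.closed_sets_axioms] ext2]
  have "x \<in> cl F2 (cl F1 A)" using 1(2) hull_subset[of "cl F1 A"] by blast
  then have "solved F2 p A B"
    using 2 cc[OF A1] cc[OF B1] unfolding solved_def by (intro bexI[of _ x] bexI[of _ y]) (auto simp: insert_commute)
  then show thesis using that good_extension_trans[OF S 1(1) 2(1)] by blast
qed

text \<open>
  Only the problems of the original system are treated, one at a time; the new points give rise to
  new problems, which are left alone.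
\<close>

lemma all_solutions:
  fixes S :: "'a set"
  assumes S: "closed_sets S F" and ext: "extendable S F" and inf: "infinite (UNIV :: 'a set)"
  shows "\<exists>S' F'. good_extension S F S' F' \<and>
    (\<forall>p\<in>S. \<forall>A\<in>F. \<forall>B\<in>F. p \<in> cl F (A \<union> B) \<and> p \<notin> A \<and> p \<notin> B \<longrightarrow> solved F' p A B)"
proof -
  interpret closed_sets S F by fact
  define Q where "Q = {(p, A, B). p \<in> S \<and> A \<in> F \<and> B \<in> F \<and> p \<in> cl F (A \<union> B) \<and> p \<notin> A \<and> p \<notin> B}"
  have "Q \<subseteq> S \<times> F \<times> F" unfolding Q_def by auto
  then have "finite Q" by (rule finite_subset) (simp add: finite_points finite_closed)
  have "\<exists>S' F'. good_extension S F S' F' \<and> (\<forall>(p, A, B)\<in>R. solved F' p A B)" if "finite R" "R \<subseteq> Q" for R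
    using that
  proof (induction R rule: finite_induct)
    case empty
    then show ?case using good_extension_refl[OF S ext] by auto
  next
    case (insert z R)
    obtain p A B where z: "z = (p, A, B)" by (cases z)
    then have Q: "p \<in> S" "A \<in> F" "B \<in> F" "p \<in> cl F (A \<union> B)" "p \<notin> A" "p \<notin> B"
      using insert.prems unfolding Q_def by auto
    obtain S1 F1 where 1: "good_extension S F S1 F1" and R: "\<forall>(p, A, B)\<in>R. solved F1 p A B"
      using insert by blast
    then interpret F1: closed_sets S1 F1 unfolding good_extension_def by blast
    have ext1: "extends S F S1 F1" "extendable S1 F1" using 1 unfolding good_extension_def by auto
    then have S1: "S \<subseteq> S1" using extends_sub by blast
    have AB1: "A \<subseteq> S1" "B \<subseteq> S1" using Q closed_sub S1 by blast+
    have trace: "cl F1 A \<inter> S = A" "cl F1 B \<inter> S = B" using extends_cl_trace[OF ext1(1)] Q by auto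
    have "p \<in> cl F1 (A \<union> B)"
      using cl_cl_extends(1)[OF S S extends_refl[OF S] ext1(1), of "A \<union> B"] Q closed_sub
        hull_subset[of "cl F (A \<union> B)" "\<lambda>X. X \<in> F1"] by blast
    then have "p \<in> cl F1 (cl F1 A \<union> cl F1 B)"
      by (rule subsetD[OF cl_mono, rotated]) (intro Un_mono hull_subset)
    moreover have "p \<notin> cl F1 A" "p \<notin> cl F1 B" using Q trace by blast+
    ultimately obtain S2 F2 where 2: "good_extension S1 F1 S2 F2" "solved F2 p (cl F1 A) (cl F1 B)"
      using solution[OF F1.closed_sets_axioms ext1(2) inf F1.cl_closed[OF AB1(1)]
        F1.cl_closed[OF AB1(2)], of p] Q S1 by blast
    have ext2: "extends S1 F1 S2 F2" using 2 unfolding good_extension_def by auto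
    note cc = cl_cl_extends(2)[OF F1.closed_sets_axioms F1.closed_sets_axioms
        extends_refl[OF F1.closed_sets_axioms] ext2]
    have "solved F2 p A B" using 2(2) cc[OF AB1(1)] cc[OF AB1(2)] unfolding solved_def by simp
    moreover have "solved F2 p A B" if "(p, A, B) \<in> R" for p A B
    proof (rule solved_extends[OF S F1.closed_sets_axioms ext1(1) ext2])
      show "A \<subseteq> S" "B \<subseteq> S" using that insert.prems closed_sub unfolding Q_def by blast+
      show "solved F1 p A B" using R that by blast
    qed
    ultimately show ?case using good_extension_trans[OF S 1 2(1)] z by blast
  qed
  from this[OF \<open>finite Q\<close> subset_refl] show ?thesis unfolding Q_def by blast
qed

section \<open>Lattices represented by closed sets\<close>

lemma lattice_congruenceI:
  assumes "equiv (carrier L) \<theta>"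
    and "\<And>x x' y y'. (x, x') \<in> \<theta> \<Longrightarrow> (y, y') \<in> \<theta> \<Longrightarrow> (x \<squnion>\<^bsub>L\<^esub> y, x' \<squnion>\<^bsub>L\<^esub> y') \<in> \<theta>"
    and "\<And>x x' y y'. (x, x') \<in> \<theta> \<Longrightarrow> (y, y') \<in> \<theta> \<Longrightarrow> (x \<sqinter>\<^bsub>L\<^esub> y, x' \<sqinter>\<^bsub>L\<^esub> y') \<in> \<theta>"
  shows "lattice_congruence L \<theta>"
  using assms by (auto simp: lattice_congruence_def)

text \<open>
  The representing family may live on any type. The given lattice is represented on
  points numbered by naturals, and the extended family is turned back into a lattice on naturals.
\<close>

locale lattice_representation = closed_sets S F + lattice L
  for S :: "'p set" and F :: "'p set set" and L :: "('a, 'm) gorder_scheme" (structure) +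
  fixes g :: "'a \<Rightarrow> 'p set"
  assumes rep_bij: "bij_betw g (carrier L) F"
    and le_iff: "x \<in> carrier L \<Longrightarrow> y \<in> carrier L \<Longrightarrow> x \<sqsubseteq> y \<longleftrightarrow> g x \<subseteq> g y"
begin

lemma rep_closed: "x \<in> carrier L \<Longrightarrow> g x \<in> F"
  using rep_bij bij_betwE by blast

lemma rep_sub: "x \<in> carrier L \<Longrightarrow> g x \<subseteq> S"
  using rep_closed closed_sub by blast

lemma rep_inject: "x \<in> carrier L \<Longrightarrow> y \<in> carrier L \<Longrightarrow> g x = g y \<longleftrightarrow> x = y"
  using rep_bij by (metis bij_betw_imp_inj_on inj_on_eq_iff)

lemma rep_surj: "X \<in> F \<Longrightarrow> \<exists>x\<in>carrier L. g x = X"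
  using rep_bij by (metis bij_betw_imp_surj_on imageE)

lemma rep_meet:
  assumes x: "x \<in> carrier L" and y: "y \<in> carrier L"
  shows "g (x \<sqinter> y) = g x \<inter> g y"
proof
  have xy: "x \<sqinter> y \<in> carrier L" using x y by simp
  show "g (x \<sqinter> y) \<subseteq> g x \<inter> g y"
    using meet_left[OF x y] meet_right[OF x y] le_iff x y xy by simp
  obtain z where z: "z \<in> carrier L" "g z = g x \<inter> g y"
    using rep_surj closed_Int rep_closed x y by meson
  then have "z \<sqsubseteq> x \<sqinter> y" using x y by (intro meet_le) (simp_all add: le_iff)
  then show "g x \<inter> g y \<subseteq> g (x \<sqinter> y)" using z xy by (simp add: le_iff)
qed

lemma rep_join:
  assumes x: "x \<in> carrier L" and y: "y \<in> carrier L"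
  shows "g (x \<squnion> y) = cl F (g x \<union> g y)"
proof
  have xy: "x \<squnion> y \<in> carrier L" using x y by simp
  show "cl F (g x \<union> g y) \<subseteq> g (x \<squnion> y)"
    using join_left[OF x y] join_right[OF x y] x y xy
    by (intro cl_least rep_closed) (simp_all add: le_iff)
  obtain z where z: "z \<in> carrier L" "g z = cl F (g x \<union> g y)"
    using rep_surj[OF cl_closed[of "g x \<union> g y"]] rep_sub x y by blast
  have "g x \<union> g y \<subseteq> g z" using z hull_subset[of "g x \<union> g y"] by simp
  then have "x \<squnion> y \<sqsubseteq> z" using x y z by (intro join_le) (simp_all add: le_iff)
  then show "g (x \<squnion> y) \<subseteq> cl F (g x \<union> g y)" using z xy by (simp add: le_iff)
qed

sublocale bounded_lattice L
proof
  obtain x where "x \<in> carrier L" "g x = {}" using rep_surj closed_empty by blast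
  then show "\<exists>x. least L x (carrier L)" unfolding least_def by (auto simp: le_iff intro!: exI[of _ x])
  obtain y where "y \<in> carrier L" "g y = S" using rep_surj closed_points by blast
  then show "\<exists>x. greatest L x (carrier L)"
    unfolding greatest_def using rep_sub by (auto simp: le_iff intro!: exI[of _ y])
qed

lemma rep_bottom: "g \<bottom> = {}"
proof -
  obtain x where "x \<in> carrier L" "g x = {}" using rep_surj closed_empty by blast
  then show ?thesis using bottom_lower[of x] le_iff[of \<bottom> x] by simp
qed

lemma rep_top: "g \<top> = S"
proof -
  obtain x where "x \<in> carrier L" "g x = S" using rep_surj closed_points by blast
  then show ?thesis using top_higher[of x] le_iff[of x \<top>] rep_sub[of \<top>] by simp
qed

lemma atom_iff: "atom L x \<longleftrightarrow> x \<in> carrier L \<and> (\<exists>s\<in>S. g x = {s})"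
proof
  assume x: "atom L x"
  then have xL: "x \<in> carrier L" by (simp add: atom_def)
  have "g x \<noteq> {}" using x rep_inject[OF xL, of \<bottom>] rep_bottom by (simp add: atom_def)
  then obtain s where s: "s \<in> g x" by blast
  then have "s \<in> S" using rep_sub[OF xL] by blast
  obtain y where y: "y \<in> carrier L" "g y = {s}" using rep_surj closed_singleton[OF \<open>s \<in> S\<close>] by blast
  then have "y \<sqsubseteq> x" "y \<noteq> \<bottom>" using s xL rep_bottom by (auto simp: le_iff)
  then have "y = x" using x y unfolding atom_def by blast
  then show "x \<in> carrier L \<and> (\<exists>s\<in>S. g x = {s})" using y \<open>s \<in> S\<close> by blast
next
  assume "x \<in> carrier L \<and> (\<exists>s\<in>S. g x = {s})"
  then obtain s where x: "x \<in> carrier L" "g x = {s}" by blast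
  have "y = \<bottom> \<or> y = x" if y: "y \<in> carrier L" "y \<sqsubseteq> x" for y
  proof -
    have "g y = {} \<or> g y = {s}" using that x by (auto simp: le_iff)
    then show ?thesis using rep_inject[OF y(1), of \<bottom>] rep_inject[OF y(1) x(1)] rep_bottom x by simp
  qed
  then show "atom L x" using x rep_bottom unfolding atom_def by auto
qed

lemma atom_of_point:
  assumes "s \<in> S"
  obtains x where "atom L x" "x \<in> carrier L" "g x = {s}"
  using rep_surj[OF closed_singleton[OF assms]] assms atom_iff by blast

lemma atomistic: "atomistic_lattice L"
proof
  fix x assume x: "x \<in> carrier L"
  let ?A = "{p. atom L p \<and> p \<sqsubseteq> x}"
  have "x \<sqsubseteq> u" if u: "u \<in> Upper L ?A" for u
  proof -
    have uL: "u \<in> carrier L" using u by (simp add: Upper_def)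
    have "s \<in> g u" if s: "s \<in> g x" for s
    proof -
      obtain p where p: "atom L p" "p \<in> carrier L" "g p = {s}"
        using atom_of_point[of s] s rep_sub[OF x] by blast
      then have "p \<sqsubseteq> u" using u s x by (auto simp: Upper_def le_iff)
      then show ?thesis using p uL by (simp add: le_iff)
    qed
    then show ?thesis using x uL by (auto simp: le_iff)
  qed
  moreover have "x \<in> Upper L ?A" using x by (auto simp: Upper_def)
  ultimately have "is_lub L x ?A" unfolding least_def by (auto simp: Upper_def)
  then show "\<exists>A. (\<forall>p\<in>A. atom L p) \<and> is_lub L x A" by (intro exI[of _ ?A]) simp
qed

text \<open>
  If a minimal closed set \<open>B\<close> above \<open>A\<close> contained two points \<open>q \<noteq> r\<close> outside \<open>A\<close>, then
  \<open>A \<squnion> {q} = B = A \<squnion> {r}\<close>, although \<open>{q} \<sqinter> {r}\<close> is empty.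
\<close>

lemma extendable_if_join_semidistributive:
  assumes jsd: "join_semidistributive L"
  shows "extendable S F"
  unfolding extendable_def
proof (intro ballI impI)
  fix A assume A: "A \<in> F" "A \<noteq> S"
  then have "A \<subset> S" using closed_sub by blast
  have "finite {B \<in> F. A \<subset> B}" using finite_closed by simp
  moreover have "S \<in> {B \<in> F. A \<subset> B}" using \<open>A \<subset> S\<close> closed_points by simp
  ultimately obtain B where "B \<in> {B \<in> F. A \<subset> B}"
    and "\<forall>B'\<in>{B \<in> F. A \<subset> B}. B' \<subseteq> B \<longrightarrow> B = B'"
    using finite_has_minimal[of "{B \<in> F. A \<subset> B}"] by blast
  then have B: "B \<in> F" "A \<subset> B" and min: "\<And>B'. B' \<in> F \<Longrightarrow> A \<subset> B' \<Longrightarrow> B' \<subseteq> B \<Longrightarrow> B' = B" by auto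
  then obtain q where q: "q \<in> B" "q \<notin> A" by blast
  have BS: "B \<subseteq> S" using closed_sub[OF B(1)] .
  have gen: "cl F (A \<union> {r}) = B" if r: "r \<in> B - A" for r
  proof (rule min)
    have sub: "A \<union> {r} \<subseteq> cl F (A \<union> {r})" by (rule hull_subset)
    then show "A \<subset> cl F (A \<union> {r})" using r by blast
    show "cl F (A \<union> {r}) \<in> F" using r B BS by (intro cl_closed) blast
    show "cl F (A \<union> {r}) \<subseteq> B" using r B by (intro cl_least) auto
  qed
  obtain x where x: "x \<in> carrier L" "g x = A" using rep_surj[OF A(1)] by blast
  obtain y where y: "y \<in> carrier L" "g y = {q}" using atom_of_point[of q] q BS by blast
  have "insert q A = B"
  proof (rule ccontr)
    assume "insert q A \<noteq> B"
    then obtain r where r: "r \<in> B - A" "r \<noteq> q" using q B by blast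
    obtain z where z: "z \<in> carrier L" "g z = {r}" using atom_of_point[of r] r BS by blast
    have "g (x \<squnion> y) = g (x \<squnion> z)" using gen q r x y z by (simp add: rep_join)
    then have "x \<squnion> y = x \<squnion> z" using x y z by (simp add: rep_inject)
    then have "x \<squnion> y = x \<squnion> (y \<sqinter> z)" using jsd x y z unfolding join_semidistributive_def by blast
    moreover have "g (x \<squnion> (y \<sqinter> z)) = A" using x y z r A by (simp add: rep_join rep_meet cl_ident)
    moreover have "g (x \<squnion> y) = B" using gen q x y by (simp add: rep_join)
    ultimately show False using B(2) by simp
  qed
  then show "\<exists>q\<in>S - A. insert q A \<in> F" using q B BS by blast
qed

text \<open>
  A point \<open>w\<close> that can be removed from \<open>x \<squnion> y = x \<squnion> z\<close> without losing \<open>x \<squnion> (y \<sqinter> z)\<close> has to lie in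
  both \<open>y\<close> and \<open>z\<close>, since otherwise one of the two joins would be smaller. Then it lies in
  \<open>y \<sqinter> z\<close>, a contradiction.
\<close>

lemma join_semidistributive_if_extendable:
  assumes ext: "extendable S F"
  shows "join_semidistributive L"
  unfolding join_semidistributive_def
proof (intro conjI ballI impI)
  show "lattice L" by (rule lattice_axioms)
  fix x y z assume L: "x \<in> carrier L" "y \<in> carrier L" "z \<in> carrier L" and eq: "x \<squnion> y = x \<squnion> z"
  let ?V = "cl F (g x \<union> g y \<inter> g z)" and ?W = "cl F (g x \<union> g y)"
  have W: "?W = cl F (g x \<union> g z)" using eq L by (metis rep_join)
  have sub: "g x \<union> g y \<subseteq> ?W" "g x \<union> g z \<subseteq> ?W"
    unfolding W by (subst W[symmetric], rule hull_subset) (rule hull_subset)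
  have sub': "g x \<union> g y \<inter> g z \<subseteq> ?V" by (rule hull_subset)
  have F: "?V \<in> F" "?W \<in> F" using rep_sub L by (auto intro!: cl_closed)
  have "?V = ?W"
  proof (rule ccontr)
    assume "?V \<noteq> ?W"
    moreover have "?V \<subseteq> ?W" by (rule cl_mono) blast
    ultimately obtain w where w: "w \<in> ?W - ?V" "?W - {w} \<in> F"
      using remove_within[OF ext F] by blast
    have "w \<in> g y"
    proof (rule ccontr)
      assume "w \<notin> g y"
      then have "?W \<subseteq> ?W - {w}" using w sub sub' by (intro cl_least) blast+
      then show False using w by blast
    qed
    moreover have "w \<in> g z"
    proof (rule ccontr)
      assume "w \<notin> g z"
      then have "cl F (g x \<union> g z) \<subseteq> ?W - {w}" using w sub sub' by (intro cl_least) blast+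
      then show False using w W by blast
    qed
    ultimately show False using w sub' by blast
  qed
  then have "g (x \<squnion> (y \<sqinter> z)) = g (x \<squnion> y)" using L by (simp add: rep_join rep_meet)
  then show "x \<squnion> y = x \<squnion> (y \<sqinter> z)" using L by (simp add: rep_inject)
qed

lemma congruence_of_congruence_set:
  assumes T: "T \<in> congruence_sets S F"
  shows "lattice_congruence L {(x, y). x \<in> carrier L \<and> y \<in> carrier L \<and> g x - T = g y - T}"
    (is "lattice_congruence L ?\<theta>")
proof -
  have 1: "cl F (X \<union> Y) - T \<subseteq> cl F (X' \<union> Y')"
    if "X \<subseteq> S" "Y \<subseteq> S" "X - T = X' - T" "Y - T = Y' - T" for X X' Y Y'
  proof -
    have "cl F (X \<union> Y) - T \<subseteq> cl F (X \<union> Y - T)"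
      using cl_Diff_congruence_set[OF T, of "X \<union> Y"] that by blast
    also have "\<dots> \<subseteq> cl F (X' \<union> Y')" using that by (intro cl_mono) blast
    finally show ?thesis .
  qed
  have 2: "cl F (X \<union> Y) - T = cl F (X' \<union> Y') - T"
    if "X \<subseteq> S" "Y \<subseteq> S" "X' \<subseteq> S" "Y' \<subseteq> S" "X - T = X' - T" "Y - T = Y' - T" for X X' Y Y'
    using 1[of X Y X' Y'] 1[of X' Y' X Y] that by auto
  have equiv: "equiv (carrier L) ?\<theta>"
    by (intro equivI refl_onI symI transI) auto
  have *: "(x \<squnion> y, x' \<squnion> y') \<in> ?\<theta> \<and> (x \<sqinter> y, x' \<sqinter> y') \<in> ?\<theta>"
    if "(x, x') \<in> ?\<theta>" "(y, y') \<in> ?\<theta>" for x x' y y'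
  proof -
    have "g x \<inter> g y - T = g x' \<inter> g y' - T" using that by blast
    then show ?thesis using that 2[of "g x" "g y" "g x'" "g y'"] rep_sub
      by (simp add: rep_join rep_meet)
  qed
  show ?thesis
  proof (rule lattice_congruenceI[OF equiv])
    show "(x \<squnion> y, x' \<squnion> y') \<in> ?\<theta>" if "(x, x') \<in> ?\<theta>" "(y, y') \<in> ?\<theta>" for x x' y y'
      using *[OF that] by (rule conjunct1)
    show "(x \<sqinter> y, x' \<sqinter> y') \<in> ?\<theta>" if "(x, x') \<in> ?\<theta>" "(y, y') \<in> ?\<theta>" for x x' y y'
      using *[OF that] by (rule conjunct2)
  qed
qed

text \<open>
  Every \<open>y\<close> is congruent to its join with all atoms of \<open>T\<close>, and elements that agree outside \<open>T\<close>
  have the same join with \<open>T\<close>.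
\<close>

lemma congruence_set_of_congruence:
  assumes \<theta>: "lattice_congruence L \<theta>"
  obtains T where "T \<in> congruence_sets S F"
    and "\<theta> = {(x, y). x \<in> carrier L \<and> y \<in> carrier L \<and> g x - T = g y - T}"
proof -
  have equiv: "equiv (carrier L) \<theta>" using \<theta> unfolding lattice_congruence_def by blast
  have cong: "(x \<squnion> y, x' \<squnion> y') \<in> \<theta>" "(x \<sqinter> y, x' \<sqinter> y') \<in> \<theta>"
    if "(x, x') \<in> \<theta>" "(y, y') \<in> \<theta>" for x x' y y'
    using \<theta> that unfolding lattice_congruence_def by blast+
  have refl: "(x, x) \<in> \<theta>" if "x \<in> carrier L" for x
    using equiv that by (simp add: equiv_def refl_on_def)
  have sym: "(y, x) \<in> \<theta>" if "(x, y) \<in> \<theta>" for x y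
    using equiv that by (meson equivE symD)
  have trans: "(x, z) \<in> \<theta>" if "(x, y) \<in> \<theta>" "(y, z) \<in> \<theta>" for x y z
    using equiv that by (meson equivE transD)
  have carr: "x \<in> carrier L" "y \<in> carrier L" if "(x, y) \<in> \<theta>" for x y
    using equiv_class_eq_iff[OF equiv] that by blast+
  define T where "T = {s \<in> S. \<exists>p\<in>carrier L. g p = {s} \<and> (p, \<bottom>) \<in> \<theta>}"
  have TS: "T \<subseteq> S" and fin: "finite T" using finite_points by (auto simp: T_def)
  have le: "g x - T \<subseteq> g y" if xy: "(x, y) \<in> \<theta>" for x y
  proof
    fix s assume s: "s \<in> g x - T"
    show "s \<in> g y"
    proof (rule ccontr)
      assume "s \<notin> g y"
      have L: "x \<in> carrier L" "y \<in> carrier L" using carr xy by auto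
      obtain p where p: "p \<in> carrier L" "g p = {s}" using atom_of_point[of s] s rep_sub[OF L(1)] by blast
      have "g (x \<sqinter> p) = g p" "g (y \<sqinter> p) = g \<bottom>"
        using L p s \<open>s \<notin> g y\<close> rep_bottom by (auto simp: rep_meet)
      then have "x \<sqinter> p = p" "y \<sqinter> p = \<bottom>"
        using L p by (metis rep_inject meet_closed bottom_closed)+
      then have "(p, \<bottom>) \<in> \<theta>" using cong(2)[OF xy refl[OF p(1)]] by simp
      then show False using s p rep_sub[OF L(1)] by (auto simp: T_def)
    qed
  qed
  have absorb: "\<exists>z. (z, y) \<in> \<theta> \<and> g z = cl F (g y \<union> U)" if "finite U" "U \<subseteq> T" "y \<in> carrier L" for U y
    using that
  proof (induction U rule: finite_induct)
    case empty
    then show ?case using refl cl_ident[OF rep_closed[of y]] by (intro exI[of _ y]) simp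
  next
    case (insert s U)
    then obtain z where z: "(z, y) \<in> \<theta>" "g z = cl F (g y \<union> U)" by blast
    obtain p where p: "p \<in> carrier L" "g p = {s}" "(p, \<bottom>) \<in> \<theta>" using insert.prems by (auto simp: T_def)
    have "g (y \<squnion> \<bottom>) = g y" using insert.prems rep_closed by (simp add: rep_join rep_bottom cl_ident)
    then have "y \<squnion> \<bottom> = y" using insert.prems by (simp add: rep_inject)
    then have "(z \<squnion> p, y) \<in> \<theta>" using cong(1)[OF z(1) p(3)] by simp
    moreover have "g (z \<squnion> p) = cl F (cl F (g y \<union> U) \<union> {s})"
      using rep_join[OF carr(1)[OF z(1)] p(1)] z(2) p(2) by simp
    then have "g (z \<squnion> p) = cl F (g y \<union> insert s U)"
      using hull_Un_left[of "\<lambda>X. X \<in> F" "g y \<union> U" "{s}"] by simp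
    ultimately show ?case by blast
  qed
  have "T \<in> congruence_sets S F"
    unfolding congruence_sets_def
  proof (intro CollectI conjI ballI TS)
    fix Y assume "Y \<in> F"
    then obtain y where y: "y \<in> carrier L" "g y = Y" using rep_surj by blast
    then obtain z where z: "(z, y) \<in> \<theta>" "g z = cl F (Y \<union> T)" using absorb[OF fin] by blast
    have "Y \<union> T \<subseteq> cl F (Y \<union> T)" by (rule hull_subset)
    moreover have "cl F (Y \<union> T) \<subseteq> Y \<union> T" using le[OF z(1)] z y by blast
    ultimately have "Y \<union> T = g z" using z by (metis subset_antisym)
    then show "Y \<union> T \<in> F" using rep_closed[OF carr(1)[OF z(1)]] by simp
  qed
  moreover have "\<theta> = {(x, y). x \<in> carrier L \<and> y \<in> carrier L \<and> g x - T = g y - T}"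
  proof (intro equalityI subsetI)
    fix w assume "w \<in> \<theta>"
    moreover obtain x y where "w = (x, y)" by (cases w)
    ultimately have xy: "(x, y) \<in> \<theta>" "w = (x, y)" by auto
    then have "g x - T = g y - T" using le[of x y] le[of y x] sym by blast
    then show "w \<in> {(x, y). x \<in> carrier L \<and> y \<in> carrier L \<and> g x - T = g y - T}"
      using carr[OF xy(1)] xy by simp
  next
    fix w assume "w \<in> {(x, y). x \<in> carrier L \<and> y \<in> carrier L \<and> g x - T = g y - T}"
    then obtain x y where w: "w = (x, y)" and L: "x \<in> carrier L" "y \<in> carrier L"
      and eq: "g x - T = g y - T" by blast
    obtain u v where u: "(u, x) \<in> \<theta>" "g u = cl F (g x \<union> T)" and v: "(v, y) \<in> \<theta>" "g v = cl F (g y \<union> T)"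
      using absorb[OF fin subset_refl] L by meson
    have "g x \<union> T = g y \<union> T" using eq by blast
    then have "g u = g v" using u v by simp
    then have "u = v" using carr[OF u(1)] carr[OF v(1)] by (simp add: rep_inject)
    then show "w \<in> \<theta>" using w u v sym trans by blast
  qed
  ultimately show thesis by (rule that)
qed

end

text \<open>
  The properties of an extension of closure systems, read off in the lattices that they represent.
\<close>

lemma
  assumes "lattice_representation S F L g" "lattice_representation S' F' L' g'"
    and ext: "extends S F S' F'"
    and f: "\<And>x. x \<in> carrier L \<Longrightarrow> f x \<in> carrier L' \<and> g' (f x) = cl F' (g x)"
  shows atom_embedding_if_extends: "atom_embedding L L' f"
    and congruence_extension_if_extends: "congruence_extension_property L L' f"
    and solves_if_solved: "(\<And>p A B. p \<in> S \<Longrightarrow> A \<in> F \<Longrightarrow> B \<in> F \<Longrightarrow> p \<in> cl F (A \<union> B) \<Longrightarrow> p \<notin> A \<Longrightarrow> p \<notin> B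
      \<Longrightarrow> solved F' p A B) \<Longrightarrow> solves_biatomicity_problems L L' f"
proof -
  interpret K: lattice_representation S F L g by fact
  interpret L: lattice_representation S' F' L' g' by fact
  note fL = f[THEN conjunct1] and rep_f = f[THEN conjunct2]
  have trace: "g' (f x) \<inter> S = g x" if "x \<in> carrier L" for x
    using extends_cl_trace[OF ext K.rep_closed[OF that]] rep_f[OF that] by simp
  have rep_point: "g' (f p) = {s}" if "p \<in> carrier L" "g p = {s}" for p s
  proof -
    have "s \<in> S'" using that K.rep_sub[OF that(1)] extends_sub[OF ext] by auto
    then show ?thesis using rep_f[OF that(1)] that(2) cl_ident L.closed_singleton by metis
  qed
  have join: "f (x \<squnion>\<^bsub>L\<^esub> y) = f x \<squnion>\<^bsub>L'\<^esub> f y" if "x \<in> carrier L" "y \<in> carrier L" for x y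
  proof -
    have sub: "g x \<union> g y \<subseteq> S" using K.rep_sub that by blast
    have "g' (f (x \<squnion>\<^bsub>L\<^esub> y)) = cl F' (g x \<union> g y)"
      using rep_f K.rep_join cl_cl_extends(1)[OF K.closed_sets_axioms K.closed_sets_axioms
          extends_refl[OF K.closed_sets_axioms] ext sub] that by simp
    also have "\<dots> = cl F' (cl F' (g x) \<union> cl F' (g y))"
      by (subst hull_Un_left, subst hull_Un_right) (rule refl)
    also have "\<dots> = g' (f x \<squnion>\<^bsub>L'\<^esub> f y)" using that fL rep_f by (simp add: L.rep_join)
    finally show ?thesis using that fL by (simp add: L.rep_inject)
  qed
  have meet: "f (x \<sqinter>\<^bsub>L\<^esub> y) = f x \<sqinter>\<^bsub>L'\<^esub> f y" if "x \<in> carrier L" "y \<in> carrier L" for x y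
  proof -
    have "cl F' (g x \<inter> g y) = cl F' (g x) \<inter> cl F' (g y)"
      using extends_cl_Int[OF ext K.rep_closed[OF that(1)] K.rep_closed[OF that(2)]]
        cl_mono[of "g x \<inter> g y" "g x" F'] cl_mono[of "g x \<inter> g y" "g y" F'] by blast
    then have "g' (f (x \<sqinter>\<^bsub>L\<^esub> y)) = g' (f x \<sqinter>\<^bsub>L'\<^esub> f y)"
      using that rep_f fL by (simp add: K.rep_meet L.rep_meet)
    then show ?thesis using that fL by (simp add: L.rep_inject)
  qed
  have "lattice_hom L L' f"
    using fL join meet K.lattice_axioms L.lattice_axioms
    by (auto simp: lattice_hom_def join_pres_def meet_pres_def)
  moreover have "inj_on f (carrier L)"
    using trace K.rep_inject by (metis inj_onI)
  moreover have "f \<bottom>\<^bsub>L\<^esub> = \<bottom>\<^bsub>L'\<^esub>"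
  proof -
    have "g' (f \<bottom>\<^bsub>L\<^esub>) = {}" using rep_f[OF K.bottom_closed] K.rep_bottom cl_ident[OF L.closed_empty] by simp
    then show ?thesis using L.rep_inject[OF fL[OF K.bottom_closed] L.bottom_closed] L.rep_bottom by simp
  qed
  moreover have "f \<top>\<^bsub>L\<^esub> = \<top>\<^bsub>L'\<^esub>"
  proof -
    have "g' (f \<top>\<^bsub>L\<^esub>) = S'" using rep_f[OF K.top_closed] K.rep_top extends_points[OF ext] by simp
    then show ?thesis using L.rep_inject[OF fL[OF K.top_closed] L.top_closed] L.rep_top by simp
  qed
  moreover have "atom L' (f p)" if p: "atom L p" for p
  proof -
    obtain s where s: "p \<in> carrier L" "s \<in> S" "g p = {s}" using p K.atom_iff by blast
    then show ?thesis using rep_point[OF s(1,3)] fL extends_sub[OF ext] L.atom_iff by blast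
  qed
  ultimately show "atom_embedding L L' f" unfolding atom_embedding_def by blast
  show "congruence_extension_property L L' f"
    unfolding congruence_extension_property_def
  proof (intro allI impI)
    fix \<theta> assume "lattice_congruence L \<theta>"
    then obtain T where T: "T \<in> congruence_sets S F"
      and \<theta>: "\<theta> = {(x, y). x \<in> carrier L \<and> y \<in> carrier L \<and> g x - T = g y - T}"
      by (rule K.congruence_set_of_congruence)
    obtain T' where T': "T' \<in> congruence_sets S' F'" "T' \<inter> S = T"
      using extends_congruence_set[OF ext T] by blast
    let ?\<psi> = "{(x, y). x \<in> carrier L' \<and> y \<in> carrier L' \<and> g' x - T' = g' y - T'}"
    \<comment> \<open>Agreement outside \<open>T\<close> propagates to the new points, since \<open>g' (f y) \<union> T'\<close> is closed and contains \<open>g x\<close>.\<close>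
    have le: "g' (f x) - T' \<subseteq> g' (f y)"
      if "x \<in> carrier L" "y \<in> carrier L" "g x - T = g y - T" for x y
    proof -
      have "g x \<subseteq> g' (f y) \<union> T'" using that trace[OF that(2)] T'(2) by blast
      moreover have "g' (f y) \<union> T' \<in> F'"
        using L.congruence_set_Un[OF T'(1)] L.rep_closed fL that(2) by blast
      ultimately have "cl F' (g x) \<subseteq> g' (f y) \<union> T'" by (rule cl_least)
      then show ?thesis using rep_f[OF that(1)] by blast
    qed
    have "g x - T = g y - T \<longleftrightarrow> g' (f x) - T' = g' (f y) - T'" (is "?l \<longleftrightarrow> ?r")
      if xy: "x \<in> carrier L" "y \<in> carrier L" for x y
    proof
      assume ?l
      then show ?r using le[OF xy] le[OF xy(2) xy(1)] by blast
    next
      assume ?r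
      then show ?l using trace[OF xy(1)] trace[OF xy(2)] T'(2) by blast
    qed
    then have "\<theta> = inv_image ?\<psi> f \<inter> carrier L \<times> carrier L"
      unfolding \<theta> using fL by (auto simp: inv_image_def)
    then show "\<exists>\<psi>. lattice_congruence L' \<psi> \<and> \<theta> = inv_image \<psi> f \<inter> carrier L \<times> carrier L"
      using L.congruence_of_congruence_set[OF T'(1)] by blast
  qed
  show "solves_biatomicity_problems L L' f"
    if solved: "\<And>p A B. p \<in> S \<Longrightarrow> A \<in> F \<Longrightarrow> B \<in> F \<Longrightarrow> p \<in> cl F (A \<union> B) \<Longrightarrow> p \<notin> A \<Longrightarrow> p \<notin> B
      \<Longrightarrow> solved F' p A B"
    unfolding solves_biatomicity_problems_def
  proof (intro allI impI, elim conjE)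
    fix p a b
    assume p: "atom L p" and "a \<in> carrier L - {\<bottom>\<^bsub>L\<^esub>}" "b \<in> carrier L - {\<bottom>\<^bsub>L\<^esub>}"
      and le: "p \<sqsubseteq>\<^bsub>L\<^esub> a \<squnion>\<^bsub>L\<^esub> b" "\<not> p \<sqsubseteq>\<^bsub>L\<^esub> a" "\<not> p \<sqsubseteq>\<^bsub>L\<^esub> b"
    then have ab: "a \<in> carrier L" "b \<in> carrier L" by auto
    obtain s where s: "p \<in> carrier L" "s \<in> S" "g p = {s}" using p K.atom_iff by blast
    then have "s \<in> cl F (g a \<union> g b)" "s \<notin> g a" "s \<notin> g b"
      using le ab K.join_closed[OF ab] by (simp_all add: K.le_iff K.rep_join)
    then obtain x y where xy: "x \<in> cl F' (g a)" "y \<in> cl F' (g b)" "s \<in> cl F' {x, y}"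
      using solved[of s "g a" "g b"] s ab K.rep_closed unfolding solved_def by blast
    have xy': "x \<in> g' (f a)" "y \<in> g' (f b)" using xy rep_f ab by auto
    then have "x \<in> S'" "y \<in> S'" using L.rep_sub fL ab by blast+
    then obtain u v where u: "atom L' u" "u \<in> carrier L'" "g' u = {x}"
      and v: "atom L' v" "v \<in> carrier L'" "g' v = {y}" by (metis L.atom_of_point)
    have "f p \<sqsubseteq>\<^bsub>L'\<^esub> u \<squnion>\<^bsub>L'\<^esub> v"
      using u v s fL rep_point[OF s(1,3)] xy(3)
      by (simp add: L.le_iff L.rep_join insert_commute)
    moreover have "u \<sqsubseteq>\<^bsub>L'\<^esub> f a" "v \<sqsubseteq>\<^bsub>L'\<^esub> f b" using u v xy' fL ab by (simp_all add: L.le_iff)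
    ultimately show "\<exists>x y. atom L' x \<and> atom L' y \<and> x \<sqsubseteq>\<^bsub>L'\<^esub> f a \<and> y \<sqsubseteq>\<^bsub>L'\<^esub> f b \<and> f p \<sqsubseteq>\<^bsub>L'\<^esub> x \<squnion>\<^bsub>L'\<^esub> y"
      using u(1) v(1) by blast
  qed
qed

section \<open>Least preimages from separated congruences\<close>

lemma sublattice_induct:
  assumes gen: "\<forall>A. sublattice K A \<and> X \<subseteq> A \<longrightarrow> A = carrier K" and "lattice K" "X \<subseteq> carrier K"
    and k: "k \<in> carrier K"
    and base: "\<And>x. x \<in> X \<Longrightarrow> P x"
    and join: "\<And>x y. x \<in> carrier K \<Longrightarrow> y \<in> carrier K \<Longrightarrow> P x \<Longrightarrow> P y \<Longrightarrow> P (x \<squnion>\<^bsub>K\<^esub> y)"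
    and meet: "\<And>x y. x \<in> carrier K \<Longrightarrow> y \<in> carrier K \<Longrightarrow> P x \<Longrightarrow> P y \<Longrightarrow> P (x \<sqinter>\<^bsub>K\<^esub> y)"
  shows "P k"
proof -
  interpret lattice K by fact
  have "{k \<in> carrier K. P k} = carrier K"
    using assms(3) base join meet by (intro gen[rule_format]) (auto simp: sublattice_def)
  then show ?thesis using k by blast
qed

lemma (in lattice) finite_lower_bound:
  assumes "finite M" "M \<noteq> {}" "M \<subseteq> D" "D \<subseteq> carrier L"
    and "\<And>x y. x \<in> D \<Longrightarrow> y \<in> D \<Longrightarrow> x \<sqinter> y \<in> D"
  shows "\<exists>u\<in>D. \<forall>m\<in>M. u \<sqsubseteq> m"
  using assms(1-3)
proof (induction M rule: finite_ne_induct)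
  case (singleton m)
  then show ?case using assms(4) by (intro bexI[of _ m]) auto
next
  case (insert m M)
  then obtain u where u: "u \<in> D" "\<forall>m\<in>M. u \<sqsubseteq> m" by blast
  have m: "m \<in> D" and carr: "u \<in> carrier L" "m \<in> carrier L" using insert.prems u assms(4) by auto
  have "M \<subseteq> carrier L" using insert.prems assms(4) by auto
  then have "u \<sqinter> m \<sqsubseteq> n" if "n \<in> M" for n
    using le_trans[OF meet_left[OF carr], of n] u that carr by auto
  then show ?case using assms(5)[OF u(1) m] meet_right[OF carr] by auto
qed

lemma (in lattice) finite_upper_bound:
  assumes "finite M" "M \<noteq> {}" "M \<subseteq> carrier L"
  shows "\<exists>u\<in>carrier L. \<forall>m\<in>M. m \<sqsubseteq> u"
  using assms
proof (induction M rule: finite_ne_induct)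
  case (singleton m)
  then show ?case by auto
next
  case (insert m M)
  then obtain u where u: "u \<in> carrier L" "\<forall>m\<in>M. m \<sqsubseteq> u" by blast
  have m: "m \<in> carrier L" "M \<subseteq> carrier L" using insert.prems by auto
  have "n \<sqsubseteq> u \<squnion> m" if "n \<in> M" for n
    using le_trans[OF _ join_left[OF u(1) m(1)], of n] u that m by auto
  then show ?case using join_right[OF u(1) m(1)] join_closed[OF u(1) m(1)] by (intro bexI[of _ "u \<squnion> m"]) auto
qed

context lattice_representation
begin

text \<open>
  \<open>LB C\<close> says that the elements mapped above all points of \<open>C\<close> have a least one, if there are any.
  It suffices to prove this for single points. Go down a chain of congruence sets from \<open>S\<close> to
  \<open>{}\<close>: when the chain drops \<open>q\<close>, every set that generates but does not contain \<open>q\<close> can be thinned out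
  to points dropped before \<open>q\<close>, whose least preimages are known. The least preimage of \<open>q\<close> is then the meet
  of the finitely many generators and joins of known least preimages that are mapped above \<open>q\<close>.
\<close>

lemma lower_bounded_if_congruence_sets_extendable:
  assumes con: "extendable S (congruence_sets S F)"
  shows "lower_bounded_lattice L"
  unfolding lower_bounded_lattice_def
proof (intro conjI allI impI, rule lattice_axioms, elim conjE)
  fix K :: "nat gorder" and f
  assume fg: "finitely_generated_lattice K" and hom: "lattice_hom K L f"
  from fg obtain X where X: "lattice K" "finite X" "X \<subseteq> carrier K"
    and gen: "\<forall>A. sublattice K A \<and> X \<subseteq> A \<longrightarrow> A = carrier K"
    unfolding finitely_generated_lattice_def by (elim conjE exE) simp
  interpret K: lattice K by (rule X)
  note K_induct = sublattice_induct[OF gen X(1,3), consumes 1, case_names base join meet]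
  have fL: "f k \<in> carrier L" if "k \<in> carrier K" for k
    using hom that by (auto simp: lattice_hom_def)
  define h where "h k = g (f k)" for k
  have h_sub: "h k \<subseteq> S" and h_closed: "h k \<in> F" if "k \<in> carrier K" for k
    using that fL rep_sub rep_closed by (auto simp: h_def)
  have h_join: "h (k \<squnion>\<^bsub>K\<^esub> l) = cl F (h k \<union> h l)" and h_meet: "h (k \<sqinter>\<^bsub>K\<^esub> l) = h k \<inter> h l"
    if "k \<in> carrier K" "l \<in> carrier K" for k l
    using that hom fL by (auto simp: h_def lattice_hom_def join_pres_def meet_pres_def rep_join rep_meet)
  have h_join_sub: "h k \<union> h l \<subseteq> h (k \<squnion>\<^bsub>K\<^esub> l)" if "k \<in> carrier K" "l \<in> carrier K" for k l
    using h_join[OF that] hull_subset[of "h k \<union> h l"] by simp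
  have h_mono: "h k \<subseteq> h l" if "k \<in> carrier K" "l \<in> carrier K" "k \<sqsubseteq>\<^bsub>K\<^esub> l" for k l
    using that K.le_iff_meet[of k l] h_join_sub[of k l] by simp
  define LB where "LB C \<longleftrightarrow> {k \<in> carrier K. C \<subseteq> h k} = {} \<or> (\<exists>m. least K m {k \<in> carrier K. C \<subseteq> h k})" for C
  have LB_empty: "LB {}"
  proof (cases "carrier K = {}")
    case True
    then show ?thesis by (simp add: LB_def)
  next
    case False
    then have "X \<noteq> {}" using gen[rule_format, of "{}"] by (auto simp: sublattice_def)
    then obtain u where u: "u \<in> carrier K" "\<forall>x\<in>X. u \<sqsubseteq>\<^bsub>K\<^esub> x"
      using K.finite_lower_bound[OF X(2) _ X(3) subset_refl] by auto
    have "u \<sqsubseteq>\<^bsub>K\<^esub> k" if "k \<in> carrier K" for k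
      using that
    proof (induction rule: K_induct)
      case (join x y)
      then show ?case using K.le_trans[OF _ K.join_left[of x y], of u] u by auto
    next
      case (meet x y)
      then show ?case using u by (intro K.meet_le) auto
    qed (use u in blast)
    then show ?thesis using u by (auto simp: LB_def least_def)
  qed
  have LB_finite: "LB C" if "finite C" "\<And>s. s \<in> C \<Longrightarrow> LB {s}" for C
    using that
  proof (induction C rule: finite_induct)
    case empty
    show ?case by (rule LB_empty)
  next
    case (insert s C)
    show ?case
    proof (cases "{k \<in> carrier K. insert s C \<subseteq> h k} = {}")
      case True
      then show ?thesis by (simp add: LB_def)
    next
      case False
      have "LB C" "LB {s}" using insert by blast+
      then obtain m n where m: "least K m {k \<in> carrier K. C \<subseteq> h k}"
        and n: "least K n {k \<in> carrier K. {s} \<subseteq> h k}"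
        using False unfolding LB_def by blast
      then have mn: "m \<in> carrier K" "n \<in> carrier K" "C \<subseteq> h m" "s \<in> h n" by (auto simp: least_def)
      have "m \<squnion>\<^bsub>K\<^esub> n \<sqsubseteq>\<^bsub>K\<^esub> k" if "k \<in> carrier K" "insert s C \<subseteq> h k" for k
        using that m n mn by (intro K.join_le) (auto simp: least_def)
      then have "least K (m \<squnion>\<^bsub>K\<^esub> n) {k \<in> carrier K. insert s C \<subseteq> h k}"
        using mn h_join_sub[OF mn(1,2)] by (auto simp: least_def)
      then show ?thesis unfolding LB_def by blast
    qed
  qed
  have LB_avoid: "\<forall>s\<in>S - T. LB {s}" if "T \<in> congruence_sets S F" for T
    using that
  proof (induction "card (S - T)" arbitrary: T rule: less_induct)
    case less
    show ?case
    proof (cases "T = S")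
      case False
      then obtain q where q: "q \<in> S - T" "insert q T \<in> congruence_sets S F"
        using con less.prems unfolding extendable_def by blast
      have "card (S - insert q T) < card (S - T)"
        using q finite_points by (intro psubset_card_mono) auto
      then have IH: "\<forall>s\<in>S - insert q T. LB {s}" using less.hyps q(2) by blast
      have "LB {q}"
      proof (cases "\<exists>k\<in>carrier K. q \<in> h k")
        case False
        then show ?thesis by (auto simp: LB_def)
      next
        case True
        then obtain k0 where k0: "k0 \<in> carrier K" "q \<in> h k0" by blast
        define D where "D = {k \<in> carrier K. q \<in> h k}"
        have "X \<noteq> {}" using gen[rule_format, of "{}"] k0 by (auto simp: sublattice_def)
        then obtain t where t: "t \<in> carrier K" "\<forall>x\<in>X. x \<sqsubseteq>\<^bsub>K\<^esub> t"
          using K.finite_upper_bound[OF X(2) _ X(3)] by blast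
        have top: "k \<sqsubseteq>\<^bsub>K\<^esub> t" if "k \<in> carrier K" for k
          using that
        proof (induction rule: K_induct)
          case (join x y)
          then show ?case using t by (intro K.join_le) auto
        next
          case (meet x y)
          then show ?case using K.le_trans[OF K.meet_left[of x y], of t] t by auto
        qed (use t in blast)
        have "t \<in> D" using h_mono[OF k0(1) t(1) top[OF k0(1)]] k0(2) t(1) by (auto simp: D_def)
        \<comment> \<open>The value of \<open>\<beta> C\<close> is only meaningful if \<open>C\<close> has a preimage; intersecting with \<open>D\<close> leaves only candidates that are mapped above \<open>q\<close>, and \<open>t\<close> keeps \<open>M\<close> nonempty.\<close>
        define \<beta> where "\<beta> C = (SOME m. least K m {k \<in> carrier K. C \<subseteq> h k})" for C
        define M where "M = insert t (X \<inter> D \<union> (\<beta> ` Pow (S - insert q T) \<inter> D))"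
        have "finite M" using X(2) finite_points by (simp add: M_def)
        moreover have "M \<subseteq> D" "M \<noteq> {}" using \<open>t \<in> D\<close> by (auto simp: M_def)
        moreover have "D \<subseteq> carrier K" "\<And>x y. x \<in> D \<Longrightarrow> y \<in> D \<Longrightarrow> x \<sqinter>\<^bsub>K\<^esub> y \<in> D"
          by (auto simp: D_def h_meet)
        ultimately obtain u where u: "u \<in> D" "\<forall>m\<in>M. u \<sqsubseteq>\<^bsub>K\<^esub> m"
          using K.finite_lower_bound[of M D] by blast
        have uK: "u \<in> carrier K" using u by (simp add: D_def)
        have "q \<in> h k \<longrightarrow> u \<sqsubseteq>\<^bsub>K\<^esub> k" if "k \<in> carrier K" for k
          using that
        proof (induction rule: K_induct)
          case (base x)
          then show ?case using u X(3) by (auto simp: M_def D_def)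
        next
          case (meet x y)
          then show ?case using uK by (auto simp: h_meet intro: K.meet_le)
        next
          case (join x y)
          show ?case
          proof
            assume qxy: "q \<in> h (x \<squnion>\<^bsub>K\<^esub> y)"
            have xyK: "x \<squnion>\<^bsub>K\<^esub> y \<in> carrier K" using join by simp
            show "u \<sqsubseteq>\<^bsub>K\<^esub> x \<squnion>\<^bsub>K\<^esub> y"
            proof (cases "q \<in> h x \<or> q \<in> h y")
              case True
              then show ?thesis
                using join K.le_trans[OF _ K.join_left[of x y], of u] K.le_trans[OF _ K.join_right[of x y], of u] uK by auto
            next
              case False
              \<comment> \<open>The join cover \<open>{x, y}\<close> of \<open>q\<close> is refined to points dropped before \<open>q\<close>; their least preimage is below \<open>x \<squnion> y\<close>.\<close>
              define C where "C = h x \<union> h y - T"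
              have sub: "h x \<union> h y \<subseteq> S" using h_sub join by blast
              have C: "C \<subseteq> S - insert q T" using False sub by (auto simp: C_def)
              have qC: "q \<in> cl F C"
                using cl_Diff_congruence_set[OF less.prems sub] qxy q(1) join by (auto simp: C_def h_join)
              have xy: "x \<squnion>\<^bsub>K\<^esub> y \<in> {k \<in> carrier K. C \<subseteq> h k}"
                using h_join_sub[of x y] join xyK by (auto simp: C_def)
              have "finite C" using C finite_points finite_subset by blast
              then have "LB C" using LB_finite IH C by blast
              then have least: "least K (\<beta> C) {k \<in> carrier K. C \<subseteq> h k}"
                unfolding \<beta>_def LB_def using xy by (metis (no_types, lifting) empty_iff someI_ex)
              then have bC: "\<beta> C \<in> carrier K" "C \<subseteq> h (\<beta> C)" "\<beta> C \<sqsubseteq>\<^bsub>K\<^esub> x \<squnion>\<^bsub>K\<^esub> y"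
                using xy by (auto simp: least_def)
              then have "\<beta> C \<in> D" using qC cl_least[OF bC(2) h_closed] by (auto simp: D_def)
              then have "u \<sqsubseteq>\<^bsub>K\<^esub> \<beta> C" using u C by (auto simp: M_def)
              then show ?thesis using K.le_trans[OF _ bC(3)] bC(1) uK xyK by blast
            qed
          qed
        qed
        then have "least K u {k \<in> carrier K. {q} \<subseteq> h k}" using u by (auto simp: least_def D_def)
        then show ?thesis unfolding LB_def by blast
      qed
      then show ?thesis using IH by blast
    qed simp
  qed
  show "lower_bounded_hom K L f"
    unfolding lower_bounded_hom_def Let_def
  proof (intro conjI ballI hom)
    fix a assume a: "a \<in> carrier L"
    have "finite (g a)" "g a \<subseteq> S" using rep_sub[OF a] finite_points finite_subset by blast+
    then have "LB (g a)" using LB_finite LB_avoid[OF empty_congruence_set] by blast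
    moreover have "{k \<in> carrier K. a \<sqsubseteq> f k} = {k \<in> carrier K. g a \<subseteq> h k}"
      using fL a by (auto simp: le_iff h_def)
    ultimately show "{k \<in> carrier K. a \<sqsubseteq> f k} = {} \<or> (\<exists>m. least K m {k \<in> carrier K. a \<sqsubseteq> f k})"
      unfolding LB_def by simp
  qed
qed

end

section \<open>Free lattices\<close>

datatype (gens: 'a) lterm = Gen 'a | Jn "'a lterm" "'a lterm" | Mt "'a lterm" "'a lterm"

text \<open>
  Whitman's description of the order of a free lattice, without a transitivity rule. Its
  advantage is that the possible reasons for a meet to lie below a join can be read off from the rules.
\<close>

inductive whitman_le :: "'a lterm \<Rightarrow> 'a lterm \<Rightarrow> bool" where
  gen: "whitman_le (Gen x) (Gen x)"
| Jn_left: "whitman_le s u \<Longrightarrow> whitman_le t u \<Longrightarrow> whitman_le (Jn s t) u"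
| Mt_right: "whitman_le u s \<Longrightarrow> whitman_le u t \<Longrightarrow> whitman_le u (Mt s t)"
| Mt_left1: "whitman_le s u \<Longrightarrow> whitman_le (Mt s t) u"
| Mt_left2: "whitman_le t u \<Longrightarrow> whitman_le (Mt s t) u"
| Jn_right1: "whitman_le u s \<Longrightarrow> whitman_le u (Jn s t)"
| Jn_right2: "whitman_le u t \<Longrightarrow> whitman_le u (Jn s t)"

lemma whitman_le_refl: "whitman_le t t"
  by (induction t) (auto intro: whitman_le.intros)

text \<open>
  Cut elimination: the last rules of the two derivations either commute with the cut or
  replace the middle term by one of its components, and the total size of the terms decreases.
\<close>

lemma whitman_le_trans: "whitman_le s t \<Longrightarrow> whitman_le t u \<Longrightarrow> whitman_le s u"
proof (induction "size s + size t + size u" arbitrary: s t u rule: less_induct)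
  case less
  note IH = less.hyps
  from less.prems(1) show ?case
  proof cases
    case (gen x)
    then show ?thesis using less.prems(2) by simp
  next
    case (Jn_left s1 s2)
    then show ?thesis using IH[of s1 t u] IH[of s2 t u] less.prems(2) by (auto intro: whitman_le.Jn_left)
  next
    case (Mt_left1 s1 s2)
    then show ?thesis using IH[of s1 t u] less.prems(2) by (auto intro: whitman_le.Mt_left1)
  next
    case (Mt_left2 s2 s1)
    then show ?thesis using IH[of s2 t u] less.prems(2) by (auto intro: whitman_le.Mt_left2)
  next
    case s: (Mt_right t1 t2)
    from less.prems(2) show ?thesis
    proof cases
      case (Mt_right u1 u2)
      then show ?thesis using IH[of s t u1] IH[of s t u2] less.prems(1) by (auto intro: whitman_le.Mt_right)
    next
      case (Jn_right1 u1 u2)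
      then show ?thesis using IH[of s t u1] less.prems(1) by (auto intro: whitman_le.Jn_right1)
    next
      case (Jn_right2 u2 u1)
      then show ?thesis using IH[of s t u2] less.prems(1) by (auto intro: whitman_le.Jn_right2)
    next
      case (Mt_left1 v1 v2)
      then show ?thesis using IH[of s t1 u] s by auto
    next
      case (Mt_left2 v2 v1)
      then show ?thesis using IH[of s t2 u] s by auto
    qed (use s in auto)
  next
    case s: (Jn_right1 t1 t2)
    from less.prems(2) show ?thesis
    proof cases
      case (Mt_right u1 u2)
      then show ?thesis using IH[of s t u1] IH[of s t u2] less.prems(1) by (auto intro: whitman_le.Mt_right)
    next
      case (Jn_right1 u1 u2)
      then show ?thesis using IH[of s t u1] less.prems(1) by (auto intro: whitman_le.Jn_right1)
    next
      case (Jn_right2 u2 u1)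
      then show ?thesis using IH[of s t u2] less.prems(1) by (auto intro: whitman_le.Jn_right2)
    next
      case (Jn_left v1 v2)
      then show ?thesis using IH[of s t1 u] s by auto
    qed (use s in auto)
  next
    case s: (Jn_right2 t2 t1)
    from less.prems(2) show ?thesis
    proof cases
      case (Mt_right u1 u2)
      then show ?thesis using IH[of s t u1] IH[of s t u2] less.prems(1) by (auto intro: whitman_le.Mt_right)
    next
      case (Jn_right1 u1 u2)
      then show ?thesis using IH[of s t u1] less.prems(1) by (auto intro: whitman_le.Jn_right1)
    next
      case (Jn_right2 u2 u1)
      then show ?thesis using IH[of s t u2] less.prems(1) by (auto intro: whitman_le.Jn_right2)
    next
      case (Jn_left v1 v2)
      then show ?thesis using IH[of s t2 u] s by auto
    qed (use s in auto)
  qed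
qed

lemma whitman_le_JnD: "whitman_le (Jn s t) u \<Longrightarrow> whitman_le s u" "whitman_le (Jn s t) u \<Longrightarrow> whitman_le t u"
  by (meson whitman_le.Jn_right1 whitman_le.Jn_right2 whitman_le_refl whitman_le_trans)+

text \<open>
  A relation rather than a function, so that no enumeration of the finite set has to be chosen.
\<close>

inductive join_of :: "'a lterm set \<Rightarrow> 'a lterm \<Rightarrow> bool" where
  single: "join_of {t} t"
| insert: "join_of B j \<Longrightarrow> join_of (insert t B) (Jn t j)"

lemma join_of_exists: "finite B \<Longrightarrow> B \<noteq> {} \<Longrightarrow> \<exists>j. join_of B j"
  by (induction B rule: finite_ne_induct) (blast intro: join_of.intros)+

lemma join_of_upper: "join_of B j \<Longrightarrow> t \<in> B \<Longrightarrow> whitman_le t j"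
  by (induction rule: join_of.induct) (auto intro: whitman_le_refl whitman_le.Jn_right1 whitman_le.Jn_right2)

lemma gens_join_of: "join_of B j \<Longrightarrow> gens j = (\<Union>t\<in>B. gens t)"
  by (induction rule: join_of.induct) auto

lemma Gen_le_join_of:
  assumes "join_of B j" "whitman_le (Gen x) j"
  shows "\<exists>t\<in>B. whitman_le (Gen x) t"
  using assms
proof (induction rule: join_of.induct)
  case (insert B j t)
  from insert.prems show ?case by cases (use insert.IH in auto)
qed auto

text \<open>
  Whitman's condition for joins of several terms.
\<close>

lemma Mt_le_join_of:
  assumes "join_of B j" "whitman_le (Mt u v) j"
  shows "(\<exists>t\<in>B. whitman_le (Mt u v) t) \<or> whitman_le u j \<or> whitman_le v j"
  using assms
proof (induction rule: join_of.induct)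
  case (insert B j t)
  from insert.prems show ?case by cases (use insert.IH in \<open>auto intro: whitman_le.Jn_right2\<close>)
qed auto

context lattice
begin

primrec ev :: "'a lterm \<Rightarrow> 'a" where
  "ev (Gen x) = x"
| "ev (Jn s t) = ev s \<squnion> ev t"
| "ev (Mt s t) = ev s \<sqinter> ev t"

lemma ev_closed: "gens t \<subseteq> carrier L \<Longrightarrow> ev t \<in> carrier L"
  by (induction t) auto

lemma ev_mono: "whitman_le s t \<Longrightarrow> gens s \<subseteq> carrier L \<Longrightarrow> gens t \<subseteq> carrier L \<Longrightarrow> ev s \<sqsubseteq> ev t"
proof (induction rule: whitman_le.induct)
  case (Jn_left s u t)
  then show ?case by (auto intro!: join_le ev_closed)
next
  case (Mt_right u s t)
  then show ?case by (auto intro!: meet_le ev_closed)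
next
  case (Mt_left1 s u t)
  then show ?case by (auto intro!: le_trans[OF meet_left, where z = "ev u"] ev_closed meet_closed join_closed)
next
  case (Mt_left2 t u s)
  then show ?case by (auto intro!: le_trans[OF meet_right, where z = "ev u"] ev_closed meet_closed join_closed)
next
  case (Jn_right1 u s t)
  then show ?case by (auto intro!: le_trans[OF _ join_left, of "ev u"] ev_closed meet_closed join_closed)
next
  case (Jn_right2 u t s)
  then show ?case by (auto intro!: le_trans[OF _ join_right, of "ev u"] ev_closed meet_closed join_closed)
qed auto

end

definition terms_over :: "'a set \<Rightarrow> 'a lterm set" where
  "terms_over A = {t. gens t \<subseteq> A}"

text \<open>
  In a partial order equivalent elements are equal, so the free lattice consists of one
  chosen representative for each class of equivalent terms.
\<close>

definition normal_term :: "'a set \<Rightarrow> 'a lterm \<Rightarrow> 'a lterm" where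
  "normal_term A t = (SOME s. s \<in> terms_over A \<and> whitman_le s t \<and> whitman_le t s)"

definition free_lattice :: "'a set \<Rightarrow> 'a lterm gorder" where
  "free_lattice A = \<lparr>carrier = normal_term A ` terms_over A, eq = (=), le = whitman_le\<rparr>"

lemma terms_over_simps [simp]:
  "Gen x \<in> terms_over A \<longleftrightarrow> x \<in> A"
  "Jn s t \<in> terms_over A \<longleftrightarrow> s \<in> terms_over A \<and> t \<in> terms_over A"
  "Mt s t \<in> terms_over A \<longleftrightarrow> s \<in> terms_over A \<and> t \<in> terms_over A"
  by (auto simp: terms_over_def)

lemma
  assumes "t \<in> terms_over A"
  shows normal_term_in: "normal_term A t \<in> terms_over A"
    and normal_term_le: "whitman_le (normal_term A t) t"
    and normal_term_ge: "whitman_le t (normal_term A t)"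
proof -
  have "\<exists>s. s \<in> terms_over A \<and> whitman_le s t \<and> whitman_le t s" using assms whitman_le_refl by blast
  from someI_ex[OF this]
  show "normal_term A t \<in> terms_over A" "whitman_le (normal_term A t) t" "whitman_le t (normal_term A t)"
    by (simp_all add: normal_term_def)
qed

lemma normal_term_cong: "whitman_le s t \<Longrightarrow> whitman_le t s \<Longrightarrow> normal_term A s = normal_term A t"
proof -
  assume "whitman_le s t" "whitman_le t s"
  then have "whitman_le u s \<and> whitman_le s u \<longleftrightarrow> whitman_le u t \<and> whitman_le t u" for u using whitman_le_trans by blast
  then show ?thesis by (simp add: normal_term_def)
qed

context
  fixes A :: "'a set"
begin

lemma free_carrier: "carrier (free_lattice A) = normal_term A ` terms_over A" and free_le: "s \<sqsubseteq>\<^bsub>free_lattice A\<^esub> t \<longleftrightarrow> whitman_le s t"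
  by (simp_all add: free_lattice_def)

lemma free_carrier_sub: "k \<in> carrier (free_lattice A) \<Longrightarrow> k \<in> terms_over A"
  by (auto simp: free_carrier normal_term_in)

lemma nf_closed: "t \<in> terms_over A \<Longrightarrow> normal_term A t \<in> carrier (free_lattice A)"
  by (simp add: free_carrier)

lemma nf_ident: "k \<in> carrier (free_lattice A) \<Longrightarrow> normal_term A k = k"
  by (auto simp: free_carrier normal_term_ge normal_term_le intro!: normal_term_cong)

lemma nf_le_iff:
  assumes "t \<in> terms_over A"
  shows "whitman_le (normal_term A t) u \<longleftrightarrow> whitman_le t u" "whitman_le u (normal_term A t) \<longleftrightarrow> whitman_le u t"
  using normal_term_le[OF assms] normal_term_ge[OF assms] whitman_le_trans by blast+

lemma free_partial_order: "partial_order (free_lattice A)"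
proof
  show "x .=\<^bsub>free_lattice A\<^esub> y" if "x \<sqsubseteq>\<^bsub>free_lattice A\<^esub> y" "y \<sqsubseteq>\<^bsub>free_lattice A\<^esub> x" "x \<in> carrier (free_lattice A)" "y \<in> carrier (free_lattice A)" for x y
    using that normal_term_cong[of x y A] nf_ident[of x] nf_ident[of y]
    by (simp add: free_lattice_def)
qed (auto simp: free_lattice_def whitman_le_refl intro: whitman_le_trans)

lemma free_lub:
  assumes "x \<in> carrier (free_lattice A)" "y \<in> carrier (free_lattice A)"
  shows "is_lub (free_lattice A) (normal_term A (Jn x y)) {x, y}"
proof -
  have "Jn x y \<in> terms_over A" using assms free_carrier_sub by simp
  then show ?thesis using assms
    by (auto simp: least_def Upper_def free_le nf_le_iff nf_closed
        intro: whitman_le.intros whitman_le_refl)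
qed

lemma free_glb:
  assumes "x \<in> carrier (free_lattice A)" "y \<in> carrier (free_lattice A)"
  shows "is_glb (free_lattice A) (normal_term A (Mt x y)) {x, y}"
proof -
  have "Mt x y \<in> terms_over A" using assms free_carrier_sub by simp
  then show ?thesis using assms
    by (auto simp: greatest_def Lower_def free_le nf_le_iff nf_closed
        intro: whitman_le.intros whitman_le_refl)
qed

interpretation FL: partial_order "free_lattice A" by (rule free_partial_order)

lemma free_is_lattice: "lattice (free_lattice A)"
  by standard (blast intro: free_lub free_glb)+

lemma free_join: "x \<in> carrier (free_lattice A) \<Longrightarrow> y \<in> carrier (free_lattice A) \<Longrightarrow> x \<squnion>\<^bsub>free_lattice A\<^esub> y = normal_term A (Jn x y)"
  unfolding join_def sup_def by (rule some_equality) (use free_lub FL.least_unique in blast)+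

lemma free_meet: "x \<in> carrier (free_lattice A) \<Longrightarrow> y \<in> carrier (free_lattice A) \<Longrightarrow> x \<sqinter>\<^bsub>free_lattice A\<^esub> y = normal_term A (Mt x y)"
  unfolding meet_def inf_def by (rule some_equality) (use free_glb FL.greatest_unique in blast)+

lemma free_finitely_generated:
  assumes "finite A"
  shows "finitely_generated_lattice (free_lattice A)"
  unfolding finitely_generated_lattice_def
proof (intro conjI exI[of _ "normal_term A ` Gen ` A"] allI impI free_is_lattice)
  show "finite (normal_term A ` Gen ` A)" using assms by simp
  show "normal_term A ` Gen ` A \<subseteq> carrier (free_lattice A)" by (auto intro!: nf_closed)
  fix T assume T: "sublattice (free_lattice A) T \<and> normal_term A ` Gen ` A \<subseteq> T"
  have TK: "T \<subseteq> carrier (free_lattice A)" and cl: "\<And>x y. x \<in> T \<Longrightarrow> y \<in> T \<Longrightarrow> x \<squnion>\<^bsub>free_lattice A\<^esub> y \<in> T \<and> x \<sqinter>\<^bsub>free_lattice A\<^esub> y \<in> T"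
    using T by (auto simp: sublattice_def)
  have "normal_term A t \<in> T" if "t \<in> terms_over A" for t
    using that
  proof (induction t)
    case (Gen x)
    then show ?case using T by auto
  next
    case (Jn s t)
    then have st: "normal_term A s \<in> T" "normal_term A t \<in> T" "s \<in> terms_over A" "t \<in> terms_over A" by auto
    have "normal_term A (Jn (normal_term A s) (normal_term A t)) = normal_term A (Jn s t)"
      using st(3,4) by (intro normal_term_cong)
        (auto simp: nf_le_iff intro!: whitman_le.Jn_left intro: whitman_le.Jn_right1 whitman_le.Jn_right2 whitman_le_refl
          normal_term_le normal_term_ge)
    then show ?case using cl[OF st(1,2)] free_join[OF subsetD[OF TK st(1)] subsetD[OF TK st(2)]] by simp
  next
    case (Mt s t)
    then have st: "normal_term A s \<in> T" "normal_term A t \<in> T" "s \<in> terms_over A" "t \<in> terms_over A" by auto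
    have "normal_term A (Mt (normal_term A s) (normal_term A t)) = normal_term A (Mt s t)"
      using st(3,4) by (intro normal_term_cong)
        (auto simp: nf_le_iff intro!: whitman_le.Mt_right intro: whitman_le.Mt_left1 whitman_le.Mt_left2 whitman_le_refl
          normal_term_le normal_term_ge)
    then show ?case using cl[OF st(1,2)] free_meet[OF subsetD[OF TK st(1)] subsetD[OF TK st(2)]] by simp
  qed
  then show "T = carrier (free_lattice A)" using TK by (auto simp: free_carrier)
qed

end

context lattice
begin

lemma ev_normal_term:
  assumes "t \<in> terms_over (carrier L)"
  shows "ev (normal_term (carrier L) t) = ev t"
  using assms normal_term_in[OF assms] normal_term_le[OF assms] normal_term_ge[OF assms]
  by (intro le_antisym ev_mono ev_closed) (auto simp: terms_over_def)

lemma ev_hom: "lattice_hom (free_lattice (carrier L)) L ev"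
proof -
  let ?K = "free_lattice (carrier L)"
  have sub: "k \<in> terms_over (carrier L)" if "k \<in> carrier ?K" for k using that free_carrier_sub by blast
  then have "ev \<in> carrier ?K \<rightarrow> carrier L" by (auto simp: terms_over_def intro: ev_closed)
  moreover have "ev (x \<squnion>\<^bsub>?K\<^esub> y) = ev x \<squnion> ev y \<and> ev (x \<sqinter>\<^bsub>?K\<^esub> y) = ev x \<sqinter> ev y"
    if "x \<in> carrier ?K" "y \<in> carrier ?K" for x y
    using that sub by (simp add: free_join free_meet ev_normal_term)
  ultimately show ?thesis
    using free_is_lattice lattice_axioms by (auto simp: lattice_hom_def join_pres_def meet_pres_def)
qed

end

section \<open>Separated congruences from least preimages\<close>

context lattice_representation
begin

abbreviation terms where "terms \<equiv> terms_over (carrier L)"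

text \<open>
  The value of a least term for \<open>s\<close> turns out to be the atom \<open>{s}\<close>; its class is the
  least element of the free lattice that is mapped above this atom.
\<close>

definition least_term :: "'p \<Rightarrow> 'a lterm \<Rightarrow> bool" where
  "least_term s t \<longleftrightarrow> t \<in> terms \<and> s \<in> g (ev t) \<and> (\<forall>u\<in>terms. s \<in> g (ev u) \<longrightarrow> whitman_le t u)"

lemma ev_terms: "t \<in> terms \<Longrightarrow> ev t \<in> carrier L"
  by (simp add: terms_over_def ev_closed)

lemma least_term_exists:
  assumes lb: "lower_bounded_lattice L" and s: "s \<in> S"
  shows "\<exists>t. least_term s t"
proof -
  let ?K = "free_lattice (carrier L)"
  obtain p where p: "p \<in> carrier L" "g p = {s}" using atom_of_point[OF s] by blast
  have "finite (carrier L)" using finite_closed bij_betw_finite[OF rep_bij] by simp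
  then have "lower_bounded_hom ?K L ev"
    using lower_bounded_latticeD[OF lb free_finitely_generated ev_hom] by blast
  moreover have "normal_term (carrier L) (Gen p) \<in> {k \<in> carrier ?K. p \<sqsubseteq> ev k}" 
    using p by (simp add: nf_closed ev_normal_term)
  ultimately obtain m where m: "least ?K m {k \<in> carrier ?K. p \<sqsubseteq> ev k}"
    using p(1) unfolding lower_bounded_hom_def Let_def by blast
  have le: "p \<sqsubseteq> ev t \<longleftrightarrow> s \<in> g (ev t)" if "t \<in> terms" for t
    using p ev_terms[OF that] by (simp add: le_iff)
  have mt: "m \<in> terms" and "p \<sqsubseteq> ev m" using m free_carrier_sub by (auto simp: least_def)
  have "whitman_le m t" if t: "t \<in> terms" "s \<in> g (ev t)" for t
  proof -
    have "normal_term (carrier L) t \<in> {k \<in> carrier ?K. p \<sqsubseteq> ev k}"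
      using t le by (simp add: nf_closed ev_normal_term)
    then have "whitman_le m (normal_term (carrier L) t)" using m by (simp add: least_def free_le)
    then show ?thesis using t(1) by (simp add: nf_le_iff)
  qed
  then show ?thesis using mt \<open>p \<sqsubseteq> ev m\<close> le unfolding least_term_def by blast
qed

text \<open>
  Let \<open>b s\<close> be a least term for \<open>s\<close> of minimal size. If \<open>C\<close> generates \<open>p \<notin> C\<close>, then the points
  \<open>c \<in> C\<close> for which \<open>b c\<close> is smaller than \<open>b p\<close> already generate \<open>p\<close>. Consequently, adding to a
  congruence set \<open>T\<close> a point \<open>q \<notin> T\<close> for which \<open>b q\<close> is largest cannot make any
  further point appear.
\<close>

lemma congruence_sets_extendable_if_lower_bounded:
  assumes lb: "lower_bounded_lattice L"
  shows "extendable S (congruence_sets S F)"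
proof -
  define b where "b s = arg_min size (least_term s)" for s
  have b: "least_term s (b s)" and b_min: "\<And>t. least_term s t \<Longrightarrow> size (b s) \<le> size t" if "s \<in> S" for s
    using least_term_exists[OF lb that] arg_min_natI[of "least_term s"] arg_min_nat_le[of "least_term s"]
    unfolding b_def by blast+
  have b_terms: "b s \<in> terms" and b_least: "\<And>t. t \<in> terms \<Longrightarrow> s \<in> g (ev t) \<Longrightarrow> whitman_le (b s) t" if "s \<in> S" for s
    using b[OF that] unfolding least_term_def by blast+
  have ev_b: "g (ev (b s)) = {s}" if s: "s \<in> S" for s
  proof -
    obtain p where p: "p \<in> carrier L" "g p = {s}" using atom_of_point[OF s] by blast
    have "whitman_le (b s) (Gen p)" using p s b_least by simp
    then have "ev (b s) \<sqsubseteq> p" using ev_mono[of "b s" "Gen p"] b_terms[OF s] p(1) by (simp add: terms_over_def)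
    then have "g (ev (b s)) \<subseteq> {s}" using p ev_terms b_terms[OF s] by (simp add: le_iff)
    moreover have "s \<in> g (ev (b s))" using b[OF s] by (simp add: least_term_def)
    ultimately show ?thesis by blast
  qed
  have ev_sub: "g (ev v) \<subseteq> g (ev w)" if "whitman_le v w" "v \<in> terms" "w \<in> terms" for v w
    using that ev_mono[of v w] ev_terms by (simp add: terms_over_def le_iff)
  \<comment> \<open>Whitman's condition resolves \<open>v\<close> into subterms that lie below single terms \<open>b c\<close>; such a subterm either evaluates to \<open>{}\<close> or is equivalent to \<open>b c\<close>, hence at least as large.\<close>
  have key: "(\<exists>c\<in>C. whitman_le v (b c)) \<or> g (ev v) \<subseteq> cl F {c \<in> C. size (b c) < size v}"
    if C: "C \<subseteq> S" and j: "join_of (b ` C) j" and "v \<in> terms" "whitman_le v j" for C j v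
    using that(3,4)
  proof (induction v)
    case (Gen x)
    then show ?case using Gen_le_join_of[OF j] by auto
  next
    case (Mt v1 v2)
    have mono: "cl F {c \<in> C. size (b c) < size v1} \<subseteq> cl F {c \<in> C. size (b c) < size (Mt v1 v2)}"
      "cl F {c \<in> C. size (b c) < size v2} \<subseteq> cl F {c \<in> C. size (b c) < size (Mt v1 v2)}"
      by (intro cl_mono; auto)+
    have ev_Mt: "g (ev (Mt v1 v2)) \<subseteq> g (ev v1)" "g (ev (Mt v1 v2)) \<subseteq> g (ev v2)"
      using Mt.prems by (auto simp: rep_meet ev_terms)
    consider "\<exists>c\<in>C. whitman_le (Mt v1 v2) (b c)" | "whitman_le v1 j" | "whitman_le v2 j"
      using Mt_le_join_of[OF j Mt.prems(2)] by auto
    then show ?case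
    proof cases
      case 2
      then show ?thesis using Mt.IH(1) Mt.prems(1) mono(1) ev_Mt(1) whitman_le.Mt_left1 by (simp del: ev.simps) blast
    next
      case 3
      then show ?thesis using Mt.IH(2) Mt.prems(1) mono(2) ev_Mt(2) whitman_le.Mt_left2 by (simp del: ev.simps) blast
    qed simp
  next
    case (Jn v1 v2)
    let ?U = "{c \<in> C. size (b c) < size (Jn v1 v2)}"
    have part: "g (ev v) \<subseteq> cl F ?U"
      if v: "v \<in> terms" "size v < size (Jn v1 v2)"
        and IH: "(\<exists>c\<in>C. whitman_le v (b c)) \<or> g (ev v) \<subseteq> cl F {c \<in> C. size (b c) < size v}" for v
      using IH
    proof
      assume "\<exists>c\<in>C. whitman_le v (b c)"
      then obtain c where c: "c \<in> C" "whitman_le v (b c)" ..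
      have cS: "c \<in> S" using c C by blast
      then have sub: "g (ev v) \<subseteq> {c}" using ev_sub[OF c(2) v(1) b_terms] ev_b by simp
      show ?thesis
      proof (cases "c \<in> g (ev v)")
        case True
        then have "least_term c v"
          using b[OF cS] c(2) v(1) whitman_le_trans unfolding least_term_def by blast
        then have "c \<in> ?U" using b_min[OF cS] v(2) c(1) by fastforce
        then show ?thesis using sub hull_subset[of ?U "\<lambda>X. X \<in> F"] by blast
      qed (use sub in blast)
    next
      assume "g (ev v) \<subseteq> cl F {c \<in> C. size (b c) < size v}"
      moreover have "cl F {c \<in> C. size (b c) < size v} \<subseteq> cl F ?U" using v(2) by (intro cl_mono) auto
      ultimately show ?thesis by blast
    qed
    have v: "v1 \<in> terms" "v2 \<in> terms" "whitman_le v1 j" "whitman_le v2 j" using Jn.prems whitman_le_JnD by auto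
    have "g (ev v1) \<union> g (ev v2) \<subseteq> cl F ?U"
      using part[OF v(1) _ Jn.IH(1)] part[OF v(2) _ Jn.IH(2)] v by simp
    moreover have "cl F ?U \<in> F" using C by (intro cl_closed) auto
    ultimately have "cl F (g (ev v1) \<union> g (ev v2)) \<subseteq> cl F ?U" by (rule cl_least)
    then show ?case using v by (simp add: rep_join ev_terms)
  qed
  have descend: "p \<in> cl F {c \<in> C. size (b c) < size (b p)}"
    if C: "C \<subseteq> S" and p: "p \<in> cl F C" "p \<notin> C" for C p
  proof -
    have "C \<noteq> {}" using p(1) cl_ident[OF closed_empty] by auto
    moreover have "finite C" using C finite_points finite_subset by blast
    ultimately obtain j where j: "join_of (b ` C) j" using join_of_exists[of "b ` C"] by auto
    have "gens (b c) \<subseteq> carrier L" if "c \<in> C" for c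
      using b_terms that C by (auto simp: terms_over_def)
    then have jt: "j \<in> terms" using gens_join_of[OF j] by (auto simp: terms_over_def)
    have "c \<in> g (ev j)" if "c \<in> C" for c
      using ev_sub[OF join_of_upper[OF j] b_terms jt] ev_b C that by blast
    then have "cl F C \<subseteq> g (ev j)" using jt by (intro cl_least rep_closed ev_terms) auto
    moreover have pS: "p \<in> S" using p(1) cl_sub[OF C] by blast
    ultimately have "whitman_le (b p) j" using p(1) b_least jt by blast
    then have "(\<exists>c\<in>C. whitman_le (b p) (b c)) \<or> g (ev (b p)) \<subseteq> cl F {c \<in> C. size (b c) < size (b p)}"
      using key[OF C j b_terms[OF pS]] by blast
    moreover have "\<not> whitman_le (b p) (b c)" if "c \<in> C" for c
    proof
      assume "whitman_le (b p) (b c)"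
      moreover have "c \<in> S" using that C by blast
      ultimately have "{p} \<subseteq> {c}" using ev_sub[of "b p" "b c"] b_terms pS ev_b by metis
      then show False using that p(2) by blast
    qed
    ultimately show ?thesis using ev_b[OF pS] by blast
  qed
  show ?thesis
    unfolding extendable_def
  proof (intro ballI impI)
    fix T assume T: "T \<in> congruence_sets S F" "T \<noteq> S"
    have TS: "T \<subseteq> S" using congruence_set_sub[OF T(1)] .
    have "finite ((\<lambda>s. size (b s)) ` (S - T))" "(\<lambda>s. size (b s)) ` (S - T) \<noteq> {}" using finite_points T TS by auto
    then obtain q where q: "q \<in> S - T" and max: "\<And>s. s \<in> S - T \<Longrightarrow> size (b s) \<le> size (b q)"
      using Max_in[of "(\<lambda>s. size (b s)) ` (S - T)"] Max_ge[of "(\<lambda>s. size (b s)) ` (S - T)"] by (smt (verit) imageE imageI)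
    have "Y \<union> insert q T \<in> F" if Y: "Y \<in> F" for Y
    proof -
      let ?C = "Y \<union> insert q T"
      have CS: "?C \<subseteq> S" using closed_sub[OF Y] TS q by blast
      have "r \<in> ?C" if r: "r \<in> cl F ?C" for r
      proof (rule ccontr)
        assume nr: "r \<notin> ?C"
        have "r \<in> S" using r cl_sub[OF CS] by blast
        then have "size (b r) \<le> size (b q)" using nr max by blast
        then have "{c \<in> ?C. size (b c) < size (b r)} \<subseteq> Y \<union> T" by auto
        then have "r \<in> cl F (Y \<union> T)" using descend[OF CS r nr] cl_mono by blast
        then show False using nr cl_ident[OF congruence_set_Un[OF T(1) Y]] by blast
      qed
      then have "cl F ?C = ?C" using hull_subset[of ?C "\<lambda>X. X \<in> F"] by blast
      then show ?thesis using cl_closed[OF CS] by simp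
    qed
    then have "insert q T \<in> congruence_sets S F" using q TS unfolding congruence_sets_def by blast
    then show "\<exists>q\<in>S - T. insert q T \<in> congruence_sets S F" using q by blast
  qed
qed

end

section \<open>The embedding\<close>

text \<open>
  Each element corresponds to the set of atoms below it. The atoms are numbered, so that there is an
  unlimited supply of new points.
\<close>

lemma atomistic_lattice_representation:
  fixes L :: "'a gorder"
  assumes fin: "finite (carrier L)" and "atomistic_lattice L"
  shows "\<exists>(S :: nat set) F g. lattice_representation S F L g"
proof -
  interpret atomistic_lattice L by fact
  define At where "At = {p. atom L p}"
  have At: "At \<subseteq> carrier L" by (auto simp: At_def atom_def)
  then have finAt: "finite At" using fin finite_subset by blast
  define e where "e = to_nat_on At"
  have inj: "inj_on e At" unfolding e_def using finAt by (intro inj_on_to_nat_on countable_finite)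
  define below where "below x = {p \<in> At. p \<sqsubseteq>\<^bsub>L\<^esub> x}" for x
  have below_le: "below x \<subseteq> below y \<longleftrightarrow> x \<sqsubseteq>\<^bsub>L\<^esub> y" if xy: "x \<in> carrier L" "y \<in> carrier L" for x y
  proof
    assume le: "below x \<subseteq> below y"
    obtain A where A: "\<forall>p\<in>A. atom L p" "is_lub L x A" using join_of_atoms[OF xy(1)] by blast
    have "A \<subseteq> below x" using A xy by (auto simp: below_def At_def least_def Upper_def atom_def)
    then have "y \<in> Upper L A" using le xy by (auto simp: below_def Upper_def)
    then show "x \<sqsubseteq>\<^bsub>L\<^esub> y" using A(2) by (simp add: least_def)
  next
    assume "x \<sqsubseteq>\<^bsub>L\<^esub> y"
    then show "below x \<subseteq> below y" using le_trans[of _ x y] At xy by (auto simp: below_def)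
  qed
  define g where "g x = e ` below x" for x
  have sub: "below x \<subseteq> At" for x by (auto simp: below_def)
  have le: "g x \<subseteq> g y \<longleftrightarrow> x \<sqsubseteq>\<^bsub>L\<^esub> y" if "x \<in> carrier L" "y \<in> carrier L" for x y
  proof
    assume xy: "g x \<subseteq> g y"
    have "p \<in> below y" if "p \<in> below x" for p
      using xy that inj_on_image_mem_iff[OF inj, of p "below y"] sub by (auto simp: g_def)
    then show "x \<sqsubseteq>\<^bsub>L\<^esub> y" using below_le[OF that] by blast
  next
    assume "x \<sqsubseteq>\<^bsub>L\<^esub> y"
    then show "g x \<subseteq> g y" using below_le[OF that] by (simp add: g_def image_mono)
  qed
  have inj_g: "inj_on g (carrier L)"
    using le le_antisym by (intro inj_onI) (metis order_refl)
  have upper: "\<exists>u\<in>carrier L. \<forall>x\<in>carrier L. x \<sqsubseteq>\<^bsub>L\<^esub> u"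
    using finite_upper_bound[OF fin _ subset_refl] bottom_closed by blast
  have "closed_sets (e ` At) (g ` carrier L)"
  proof
    show "finite (e ` At)" using finAt by simp
    show "X \<subseteq> e ` At" if "X \<in> g ` carrier L" for X using that sub by (auto simp: g_def)
    obtain u where u: "u \<in> carrier L" "\<forall>x\<in>carrier L. x \<sqsubseteq>\<^bsub>L\<^esub> u" using upper by blast
    then have "below u = At" using At by (auto simp: below_def)
    then show "e ` At \<in> g ` carrier L" using u(1) by (auto simp: g_def)
    have "below \<bottom>\<^bsub>L\<^esub> = {}"
    proof -
      have "p = \<bottom>\<^bsub>L\<^esub>" if "p \<in> At" "p \<sqsubseteq>\<^bsub>L\<^esub> \<bottom>\<^bsub>L\<^esub>" for p
        using that At le_antisym[of p "\<bottom>\<^bsub>L\<^esub>"] by auto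
      then show ?thesis by (auto simp: below_def At_def atom_def)
    qed
    then show "{} \<in> g ` carrier L" by (auto simp: g_def intro!: image_eqI[of _ _ "\<bottom>\<^bsub>L\<^esub>"])
    show "{s} \<in> g ` carrier L" if s: "s \<in> e ` At" for s
    proof -
      obtain p where p: "p \<in> At" "s = e p" using s by blast
      have "below p = {p}" using p At by (auto simp: below_def At_def atom_def)
      then have "g p = {s}" using p by (simp add: g_def)
      then show ?thesis using p At by (intro image_eqI[of _ _ p]) auto
    qed
    show "X \<inter> Y \<in> g ` carrier L" if XY: "X \<in> g ` carrier L" "Y \<in> g ` carrier L" for X Y
    proof -
      obtain x y where xy: "x \<in> carrier L" "y \<in> carrier L" "X = g x" "Y = g y" using XY by blast
      have meet: "x \<sqinter>\<^bsub>L\<^esub> y \<in> carrier L" using xy by simp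
      have le_meet_iff: "p \<sqsubseteq>\<^bsub>L\<^esub> x \<sqinter>\<^bsub>L\<^esub> y \<longleftrightarrow> p \<sqsubseteq>\<^bsub>L\<^esub> x \<and> p \<sqsubseteq>\<^bsub>L\<^esub> y" if "p \<in> carrier L" for p
        using that xy(1,2) meet_le[of p x y] le_trans[OF _ meet_left[OF xy(1,2)] that meet xy(1)]
          le_trans[OF _ meet_right[OF xy(1,2)] that meet xy(2)] by blast
      have "p \<in> below (x \<sqinter>\<^bsub>L\<^esub> y) \<longleftrightarrow> p \<in> below x \<inter> below y" for p
        unfolding below_def using le_meet_iff[of p] subsetD[OF At, of p] by simp blast
      then have "below (x \<sqinter>\<^bsub>L\<^esub> y) = below x \<inter> below y" by blast
      then have "g (x \<sqinter>\<^bsub>L\<^esub> y) = X \<inter> Y"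
        using xy inj_on_image_Int[OF inj sub sub] by (simp add: g_def)
      then show ?thesis using xy by (intro image_eqI[of _ _ "x \<sqinter>\<^bsub>L\<^esub> y"]) auto
    qed
  qed
  then have "lattice_representation (e ` At) (g ` carrier L) L g"
    by (intro lattice_representation.intro lattice_axioms lattice_representation_axioms.intro)
      (use inj_g le in \<open>auto simp: bij_betw_def\<close>)
  then show ?thesis by blast
qed

lemma (in closed_sets) lattice_of_closed_sets:
  "\<exists>(L :: nat gorder) g. lattice_representation S F L g"
proof -
  define e where "e = to_nat_on F"
  define g where "g = inv_into F e"
  have inj: "inj_on e F" unfolding e_def using finite_closed by (intro inj_on_to_nat_on countable_finite)
  have ge: "g (e X) = X" if "X \<in> F" for X using inj that by (simp add: g_def)
  define L :: "nat gorder" where "L = \<lparr>carrier = e ` F, eq = (=), le = (\<lambda>i j. g i \<subseteq> g j)\<rparr>"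
  have carr: "carrier L = e ` F" and le: "i \<sqsubseteq>\<^bsub>L\<^esub> j \<longleftrightarrow> g i \<subseteq> g j" for i j by (simp_all add: L_def)
  interpret partial_order L
  proof
    show "x .=\<^bsub>L\<^esub> y" if "x \<sqsubseteq>\<^bsub>L\<^esub> y" "y \<sqsubseteq>\<^bsub>L\<^esub> x" "x \<in> carrier L" "y \<in> carrier L" for x y
      using that by (auto simp: L_def ge)
  qed (auto simp: L_def)
  have "lattice L"
  proof
    fix x y assume "x \<in> carrier L" "y \<in> carrier L"
    then obtain X Y where XY: "X \<in> F" "Y \<in> F" "x = e X" "y = e Y" by (auto simp: carr)
    have "cl F (X \<union> Y) \<in> F" using XY closed_sub by (intro cl_closed) blast
    then have "is_lub L (e (cl F (X \<union> Y))) {x, y}"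
      using XY hull_subset[of "X \<union> Y" "\<lambda>X. X \<in> F"]
      by (auto simp: least_def Upper_def carr le ge all_conj_distrib in_cl_iff)
    then show "\<exists>s. is_lub L s {x, y}" by blast
    have "is_glb L (e (X \<inter> Y)) {x, y}"
      using XY closed_Int by (auto simp: greatest_def Lower_def carr le ge)
    then show "\<exists>s. is_glb L s {x, y}" by blast
  qed
  moreover have "bij_betw g (carrier L) F"
    using inj by (auto simp: carr g_def intro: bij_betw_inv_into inj_on_imp_bij_betw)
  ultimately have "lattice_representation S F L g"
    by (intro lattice_representation.intro closed_sets_axioms lattice_representation_axioms.intro)
      (auto simp: le)
  then show ?thesis by blast
qed

theorem theorem6p1:
  fixes L :: "'a gorder"
  assumes "finite (carrier L)" and "atomistic_lattice L"
  shows
    "(join_semidistributive L \<longrightarrow>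
       (\<exists>(L' :: nat gorder) f.
          finite (carrier L') \<and> atomistic_lattice L' \<and> join_semidistributive L' \<and>
          atom_embedding L L' f \<and> congruence_extension_property L L' f \<and>
          solves_biatomicity_problems L L' f)) \<and>
     (lower_bounded_lattice L \<longrightarrow>
       (\<exists>(L' :: nat gorder) f.
          finite (carrier L') \<and> atomistic_lattice L' \<and> lower_bounded_lattice L' \<and>
          atom_embedding L L' f \<and> congruence_extension_property L L' f \<and>
          solves_biatomicity_problems L L' f))"
proof -
  obtain S :: "nat set" and F g where rep: "lattice_representation S F L g"
    using atomistic_lattice_representation[OF assms] by blast
  interpret L: lattice_representation S F L g by (rule rep)
  have main: "\<exists>(L' :: nat gorder) f. finite (carrier L') \<and> atomistic_lattice L' \<and>
      join_semidistributive L' \<and> (lower_bounded_lattice L \<longrightarrow> lower_bounded_lattice L') \<and>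
      atom_embedding L L' f \<and> congruence_extension_property L L' f \<and>
      solves_biatomicity_problems L L' f" if ext: "extendable S F"
  proof -
    obtain S' F' where good: "good_extension S F S' F'"
      and solved: "\<forall>p\<in>S. \<forall>A\<in>F. \<forall>B\<in>F. p \<in> cl F (A \<union> B) \<and> p \<notin> A \<and> p \<notin> B \<longrightarrow> solved F' p A B"
      using all_solutions[OF L.closed_sets_axioms ext infinite_UNIV_nat] by blast
    have S': "closed_sets S' F'" and extends: "extends S F S' F'" and ext': "extendable S' F'"
      and con': "extendable S (congruence_sets S F) \<Longrightarrow> extendable S' (congruence_sets S' F')"
      using good unfolding good_extension_def by blast+
    obtain L' :: "nat gorder" and g' where rep': "lattice_representation S' F' L' g'"
      using closed_sets.lattice_of_closed_sets[OF S'] by blast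
    interpret L': lattice_representation S' F' L' g' by (rule rep')
    have "\<exists>y. y \<in> carrier L' \<and> g' y = cl F' (g x)" if "x \<in> carrier L" for x
      using L'.rep_surj[OF L'.cl_closed[of "g x"]] L.rep_sub[OF that] extends_sub[OF extends] by blast
    then obtain f where f: "\<And>x. x \<in> carrier L \<Longrightarrow> f x \<in> carrier L' \<and> g' (f x) = cl F' (g x)" by metis
    have "finite (carrier L')" using L'.finite_closed bij_betw_finite[OF L'.rep_bij] by simp
    moreover have "lower_bounded_lattice L'" if "lower_bounded_lattice L"
      using L'.lower_bounded_if_congruence_sets_extendable
        con'[OF L.congruence_sets_extendable_if_lower_bounded[OF that]] .
    moreover have "solves_biatomicity_problems L L' f"
      by (rule solves_if_solved[OF rep rep' extends f]) (use solved in blast)+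
    ultimately show ?thesis
      using L'.atomistic L'.join_semidistributive_if_extendable[OF ext']
        atom_embedding_if_extends[OF rep rep' extends f]
        congruence_extension_if_extends[OF rep rep' extends f] by blast
  qed
  show ?thesis
    using main[OF L.extendable_if_join_semidistributive]
      main[OF L.extendable_if_congruence_sets_extendable
        [OF L.congruence_sets_extendable_if_lower_bounded]] by blast
qed

end
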